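(* Let $n\geqslant 2$ and let $(x_i)_{i\in\mathbb{Z}}$ be a sequence of points on the unit sphere $\Sigma^n\subseteq\mathbb{R}^{n+1}$. If $$\sup_{\ell\in\mathbb{Z}}\operatorname{dist}(x_\ell,x_{\ell+1})<0.31,$$ then the Riemannian analogue $T$ on $\Sigma^n$ of the linear $4$-point scheme with parameter $\omega=\frac1{16}$, $$(Sx)_{2i}=x_i,\qquad (Sx)_{2i+1}=-\omega x_{i-1}+\left(\tfrac12+\omega\right)x_i+\left(\tfrac12+\omega\right)x_{i+1}-\omega x_{i+2}\qquad(i\in\mathbb{Z}),$$ converges, for the input data $(x_i)_{i\in\mathbb{Z}}$, to a continuous, even $C^1$, limit function on the unit sphere.
   Context: $\Sigma^n$ carries its standard Riemannian metric, with distance $\operatorname{dist}(p,q)=\arccos\langle p,q\rangle$. $B_\rho(p)=\{y\in\Sigma^n\mid \operatorname{dist}(p,y)<\rho\}$. Riemannian analogue: for a linear binary subdivision rule $(Sx)_i=\sum_{j\in\mathbb{Z}}a_{i-2j}x_j$ with finitely supported real mask $(a_i)$ satisfying $\sum_j a_{2j}=\sum_j a_{2j+1}=1$, its Riemannian analogue $T$ is $$Tx_i=\operatorname{arg\,min}_{x\in\Sigma^n}\sum_{j\in\mathbb{Z}}a_{i-2j}\operatorname{dist}(x,x_j)^2 .$$ The minimiser is understood locally. If the points $x_j$ contributing to $Tx_i$ (those with $a_{i-2j}\neq0$) lie in a ball $B_\rho(p)$ and, with $\alpha_-$ denoting the sum of the absolute values of the negative coefficients among the $a_{i-2j}$, there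 is $\rho^*>\rho$ with $(1+2\alpha_-)\rho<\rho^*<\frac{\pi}{4}\left(1+(1+\frac{\pi}{2})\alpha_-\right)^{-1}$, then the function being minimised has a unique minimiser in $B_{\rho^*}(p)$ (a known result), and $Tx_i$ is that minimiser. Convergence: $T$ converges for input data $x$ if the iterates $x,Tx,T^2x,\dots$ are defined and the functions $f_k$ with $f_k\left(\frac{i}{2^k}\right)=T^kx_i$ for all $i\in\mathbb{Z}$, obtained by piecewise linear interpolation in coordinate charts, converge as $k\to\infty$, uniformly on compact sets, to a continuous limit function $\mathbb{R}\to\Sigma^n$. *)

theory Defs
  imports "HOL-Analysis.Analysis"
begin

text \<open>The sphere \<open>\<Sigma>\<^sup>n\<close> is \<open>sphere 0 1\<close> in a Euclidean space of dimension \<open>n + 1\<close>.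
  Masks \<open>a\<close> are meant to be finitely supported with \<open>\<Sum>j. a (i - 2 * j) = 1\<close> for all \<open>i\<close>; this is not
  built into the definitions but proved below for the mask in question.\<close>

definition sph_dist :: "'a::euclidean_space \<Rightarrow> 'a \<Rightarrow> real" where
  "sph_dist p q = arccos (p \<bullet> q)"

definition sph_ball :: "'a::euclidean_space \<Rightarrow> real \<Rightarrow> 'a set" where
  "sph_ball p \<rho> = {y \<in> sphere 0 1. sph_dist p y < \<rho>}"

definition linear_rule :: "(int \<Rightarrow> real) \<Rightarrow> (int \<Rightarrow> 'a::real_vector) \<Rightarrow> int \<Rightarrow> 'a" where
  "linear_rule a x i = (\<Sum>j | a (i - 2 * j) \<noteq> 0. a (i - 2 * j) *\<^sub>R x j)"

definition neg_part :: "(int \<Rightarrow> real) \<Rightarrow> int \<Rightarrow> real" where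
  "neg_part a i = (\<Sum>j | a (i - 2 * j) < 0. \<bar>a (i - 2 * j)\<bar>)"

definition sq_dist_sum ::
  "(int \<Rightarrow> real) \<Rightarrow> (int \<Rightarrow> 'a::euclidean_space) \<Rightarrow> int \<Rightarrow> 'a \<Rightarrow> real" where
  "sq_dist_sum a x i y = (\<Sum>j | a (i - 2 * j) \<noteq> 0. a (i - 2 * j) * (sph_dist y (x j))\<^sup>2)"

text \<open>\<open>local_minimiser a x i y\<close>: for some admissible choice of \<open>p\<close>, \<open>\<rho>\<close>, \<open>\<rho>'\<close> (where \<open>\<rho>'\<close> is
  the larger radius \<open>\<rho>\<^sup>*\<close>), \<open>y\<close> is the unique minimiser in the ball of radius \<open>\<rho>'\<close> about \<open>p\<close>.\<close>

definition local_minimiser ::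
  "(int \<Rightarrow> real) \<Rightarrow> (int \<Rightarrow> 'a::euclidean_space) \<Rightarrow> int \<Rightarrow> 'a \<Rightarrow> bool" where
  "local_minimiser a x i y \<longleftrightarrow>
     (\<exists>p \<rho> \<rho>'. p \<in> sphere 0 1 \<and>
        (\<forall>j. a (i - 2 * j) \<noteq> 0 \<longrightarrow> x j \<in> sph_ball p \<rho>) \<and>
        \<rho> < \<rho>' \<and> (1 + 2 * neg_part a i) * \<rho> < \<rho>' \<and>
        \<rho>' < pi / 4 * inverse (1 + (1 + pi / 2) * neg_part a i) \<and>
        {z. is_arg_min (sq_dist_sum a x i) (\<lambda>z. z \<in> sph_ball p \<rho>') z} = {y})"

definition riemannian_rule ::
  "(int \<Rightarrow> real) \<Rightarrow> (int \<Rightarrow> 'a::euclidean_space) \<Rightarrow> int \<Rightarrow> 'a" where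
  "riemannian_rule a x i = (THE y. local_minimiser a x i y)"

text \<open>Uniqueness is part of being defined: the minimiser must not depend on the admissible
  choice of \<open>p\<close>, \<open>\<rho>\<close>, \<open>\<rho>'\<close>. Otherwise the description above would be meaningless.\<close>

definition riemannian_rule_defined ::
  "(int \<Rightarrow> real) \<Rightarrow> (int \<Rightarrow> 'a::euclidean_space) \<Rightarrow> bool" where
  "riemannian_rule_defined a x \<longleftrightarrow> (\<forall>i. \<exists>!y. local_minimiser a x i y)"

text \<open>Exponential map of the sphere at \<open>p\<close>, and its inverse (normal coordinates centred at
  \<open>p\<close>, valid on the sphere without \<open>-p\<close>; the formula gives the junk value \<open>0\<close> at \<open>-p\<close>).\<close>

definition sph_exp :: "'a::euclidean_space \<Rightarrow> 'a \<Rightarrow> 'a" where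
  "sph_exp p v = cos (norm v) *\<^sub>R p + (sin (norm v) / norm v) *\<^sub>R v"

definition sph_log :: "'a::euclidean_space \<Rightarrow> 'a \<Rightarrow> 'a" where
  "sph_log p q = (sph_dist p q / norm (q - (p \<bullet> q) *\<^sub>R p)) *\<^sub>R (q - (p \<bullet> q) *\<^sub>R p)"

text \<open>The function taking the value \<open>X i\<close> at \<open>i / 2 ^ k\<close>; between \<open>i / 2 ^ k\<close> and
  \<open>(i + 1) / 2 ^ k\<close> it interpolates linearly in the normal coordinate chart centred at \<open>X i\<close>.\<close>

definition chart_interpolation ::
  "nat \<Rightarrow> (int \<Rightarrow> 'a::euclidean_space) \<Rightarrow> real \<Rightarrow> 'a" where
  "chart_interpolation k X t =
     (let i = \<lfloor>t * 2 ^ k\<rfloor>; s = t * 2 ^ k - of_int i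
      in sph_exp (X i) ((1 - s) *\<^sub>R sph_log (X i) (X i) + s *\<^sub>R sph_log (X i) (X (i + 1))))"

text \<open>Uniform limits are taken in the ambient norm, which on the sphere is uniformly
  equivalent to \<open>sph_dist\<close>.\<close>

definition riemannian_rule_converges_to ::
  "(int \<Rightarrow> real) \<Rightarrow> (int \<Rightarrow> 'a::euclidean_space) \<Rightarrow> (real \<Rightarrow> 'a) \<Rightarrow> bool" where
  "riemannian_rule_converges_to a x f \<longleftrightarrow>
     (\<forall>k. riemannian_rule_defined a ((riemannian_rule a ^^ k) x)) \<and>
     (\<forall>K. compact K \<longrightarrow>
        uniform_limit K (\<lambda>k. chart_interpolation k ((riemannian_rule a ^^ k) x)) f sequentially) \<and>
     continuous_on UNIV f \<and> range f \<subseteq> sphere 0 1"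

definition four_point_mask :: "real \<Rightarrow> int \<Rightarrow> real" where
  "four_point_mask \<omega> i =
     (if i = 0 then 1 else if \<bar>i\<bar> = 1 then 1 / 2 + \<omega> else if \<bar>i\<bar> = 3 then - \<omega> else 0)"

text \<open>The mask is the one of the \<open>4\<close>-point scheme, and it is finitely supported and affine
  invariant.\<close>

lemma four_point_mask_odd_nonzero:
  "{j. four_point_mask \<omega> (2 * i + 1 - 2 * j) \<noteq> 0} \<subseteq> {i - 1, i, i + 1, i + 2}"
  by (auto simp: four_point_mask_def split: if_splits)

lemma four_point_mask_even_nonzero:
  "{j. four_point_mask \<omega> (2 * i - 2 * j) \<noteq> 0} = {i}"
proof -
  have "\<bar>2 * i - 2 * j\<bar> \<noteq> 1" "\<bar>2 * i - 2 * j\<bar> \<noteq> 3" for j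
    by presburger+
  then show ?thesis
    by (auto simp: four_point_mask_def)
qed

lemma linear_rule_four_point:
  shows "linear_rule (four_point_mask \<omega>) x (2 * i) = x i"
    and "linear_rule (four_point_mask \<omega>) x (2 * i + 1) =
           (- \<omega>) *\<^sub>R x (i - 1) + (1 / 2 + \<omega>) *\<^sub>R x i
             + (1 / 2 + \<omega>) *\<^sub>R x (i + 1) + (- \<omega>) *\<^sub>R x (i + 2)"
proof -
  show "linear_rule (four_point_mask \<omega>) x (2 * i) = x i"
    unfolding linear_rule_def four_point_mask_even_nonzero by (simp add: four_point_mask_def)
  have "linear_rule (four_point_mask \<omega>) x (2 * i + 1) =
      (\<Sum>j\<in>{i - 1, i, i + 1, i + 2}. four_point_mask \<omega> (2 * i + 1 - 2 * j) *\<^sub>R x j)"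
    unfolding linear_rule_def
    by (rule sum.mono_neutral_left) (use four_point_mask_odd_nonzero in auto)
  then show "linear_rule (four_point_mask \<omega>) x (2 * i + 1) =
           (- \<omega>) *\<^sub>R x (i - 1) + (1 / 2 + \<omega>) *\<^sub>R x i
             + (1 / 2 + \<omega>) *\<^sub>R x (i + 1) + (- \<omega>) *\<^sub>R x (i + 2)"
    by (simp add: four_point_mask_def algebra_simps)
qed

lemma finite_support_four_point_mask: "finite {i. four_point_mask \<omega> i \<noteq> 0}"
  by (rule finite_subset[of _ "{-3..3}"]) (auto simp: four_point_mask_def split: if_splits)

lemma affine_four_point_mask:
  "(\<Sum>j | four_point_mask \<omega> (i - 2 * j) \<noteq> 0. four_point_mask \<omega> (i - 2 * j)) = 1"
proof -
  have "linear_rule (four_point_mask \<omega>) (\<lambda>_. 1::real) i = 1"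
  proof (cases "even i")
    case True
    then show ?thesis by (auto elim!: evenE simp: linear_rule_four_point)
  next
    case False
    then show ?thesis by (auto elim!: oddE simp: linear_rule_four_point)
  qed
  then show ?thesis by (simp add: linear_rule_def)
qed

end

theory Submission imports Defs begin

text \<open>The sphere affects the four-point rule only through terms of second order in the distances of
  neighbouring points. These distances shrink geometrically, and the linear four-point scheme is
  stable enough to tolerate such perturbations without losing \<open>C\<^sup>1\<close> smoothness.

  One step on the sphere. Points with even index are copied. The point inserted between \<open>q1\<close> and \<open>q2\<close>
  minimises \<open>(9 * dist(\<cdot>, q1)\<^sup>2 + 9 * dist(\<cdot>, q2)\<^sup>2 - dist(\<cdot>, q0)\<^sup>2 - dist(\<cdot>, q3)\<^sup>2) / 16\<close>. On a unit speed great
  circle, half the second derivative of a squared distance lies between \<open>r cot r\<close> and \<open>1\<close>,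
  where \<open>r\<close> is the distance (\<open>sq_arccos_sinusoid_deriv\<close>). So the positive weights win as long as the
  inner points are not too far away, and the cost is strictly convex on a region that contains all
  candidates for the minimiser; there it has at most one critical point (\<open>four_critical_unique\<close>).
  Strong convexity also puts the minimiser within \<open>\<delta> / 5\<close> of the midpoint of \<open>q1\<close> and \<open>q2\<close>,
  where \<open>\<delta> < 0.31\<close> bounds the distances of neighbours (\<open>four_mean_exists\<close>). Consequently every step
  multiplies this bound by at most \<open>0.7\<close>. The critical point equation shows that the inserted point
  differs from the affine combination of the four points in the ambient space by \<open>O(\<delta>\<^sup>2)\<close>
  (\<open>four_critical_error\<close>).

  The limit. After \<open>k\<close> steps the data are a sequence in the ambient space that was produced by the
  linear rule with defects \<open>O((0.7\<^sup>k)\<^sup>2) = O(0.49\<^sup>k)\<close>. The linear rule contracts second differences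
  by \<open>7 / 16\<close> in a suitably weighted norm, so the perturbed second differences are \<open>O(0.49\<^sup>k)\<close> as well
  (\<open>second_diff_decay\<close>). As \<open>2 * 0.49 < 1\<close>, the divided differences at level \<open>k\<close> are uniformly
  Cauchy; their limit is continuous and is the derivative of the limit curve
  (\<open>perturbed_four_point_C1\<close>).\<close>

section \<open>The squared arccosine of a sinusoid\<close>

lemma cos_ge_one_minus_half_sq:
  fixes r :: real
  shows "1 - r\<^sup>2 / 2 \<le> cos r"
proof -
  have "cos r = 1 - 2 * (sin (r / 2))\<^sup>2"
    using cos_double_sin[of "r / 2"] by simp
  moreover have "(sin (r / 2))\<^sup>2 \<le> (r / 2)\<^sup>2"
    using abs_sin_x_le_abs_x[of "r / 2"] by (metis abs_le_square_iff)
  ultimately show ?thesis by (simp add: power_divide)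
qed

text \<open>The difference of the two sides vanishes at \<open>0\<close> and has derivative \<open>r * sin r\<close>.\<close>

lemma mult_cos_le_sin:
  fixes r :: real
  assumes "0 \<le> r" "r \<le> pi"
  shows "r * cos r \<le> sin r"
proof -
  have "sin 0 - 0 * cos 0 \<le> sin r - r * cos r"
  proof (rule DERIV_nonneg_imp_nondecreasing[OF assms(1)])
    fix u assume u: "0 \<le> u" "u \<le> r"
    have "((\<lambda>u. sin u - u * cos u) has_real_derivative u * sin u) (at u)"
      by (auto intro!: derivative_eq_intros)
    moreover have "0 \<le> u * sin u"
      using u assms sin_ge_zero[of u] by auto
    ultimately show "\<exists>D. ((\<lambda>u. sin u - u * cos u) has_real_derivative D) (at u) \<and> 0 \<le> D"
      by blast
  qed
  then show ?thesis by simp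
qed

text \<open>This is \<open>r / sin r\<close> for \<open>c = cos r\<close>, extended continuously to \<open>r = 0\<close>. If \<open>c = y \<bullet> q\<close>, the
  gradient of \<open>(dist y q)\<^sup>2\<close> at \<open>y\<close> is \<open>- 2 * arc_ratio c\<close> times the tangential part of \<open>q\<close>,
  and this remains smooth at \<open>y = q\<close>, where the distance itself is not differentiable.\<close>

definition arc_ratio :: "real \<Rightarrow> real" where
  "arc_ratio c = (if c = 1 then 1 else arccos c / sqrt (1 - c\<^sup>2))"

lemma arc_ratio_cos:
  assumes "0 < r" "r < pi"
  shows "arc_ratio (cos r) = r / sin r"
proof -
  have s: "0 < sin r" using assms by (rule sin_gt_zero)
  have "1 - (cos r)\<^sup>2 = (sin r)\<^sup>2" by (simp add: sin_squared_eq)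
  moreover have "cos r \<noteq> 1"
    using s by (metis cos_one_sin_zero less_irrefl)
  ultimately show ?thesis
    using s assms by (simp add: arc_ratio_def arccos_cos)
qed

lemma arc_ratio_bounds:
  assumes "-1 < c" "c \<le> 1"
  shows "1 \<le> arc_ratio c" and "arc_ratio c * c \<le> 1"
    and "arc_ratio c * sqrt (1 - c\<^sup>2) = arccos c"
proof -
  have "1 \<le> arc_ratio c \<and> arc_ratio c * c \<le> 1 \<and> arc_ratio c * sqrt (1 - c\<^sup>2) = arccos c"
  proof (cases "c = 1")
    case True
    then show ?thesis by (simp add: arc_ratio_def)
  next
    case False
    define r where "r = arccos c"
    have r: "0 < r" "r < pi" and c: "c = cos r"
      using assms False arccos_lt_bounded[of c] by (auto simp: r_def)
    have s: "0 < sin r" using r by (rule sin_gt_zero)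
    have "sqrt (1 - (cos r)\<^sup>2) = sin r"
      using s by (simp add: sin_squared_eq[symmetric])
    then show ?thesis
      using s r sin_x_le_x[of r] mult_cos_le_sin[of r]
      by (simp add: c arc_ratio_cos arccos_cos field_simps)
  qed
  then show "1 \<le> arc_ratio c" "arc_ratio c * c \<le> 1"
    "arc_ratio c * sqrt (1 - c\<^sup>2) = arccos c" by auto
qed

lemma arc_ratio_le_square:
  assumes "1 / 2 \<le> c" "c \<le> 1"
  shows "arc_ratio c - 1 \<le> (arccos c)\<^sup>2"
proof -
  have "arc_ratio c \<le> 1 / c"
    using arc_ratio_bounds(2)[of c] assms by (simp add: field_simps)
  moreover have "1 / c - 1 \<le> 2 * (1 - c)"
  proof -
    have "0 \<le> (1 - c) * (2 * c - 1)" using assms by simp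
    then show ?thesis using assms by (simp add: field_simps)
  qed
  moreover have "2 * (1 - c) \<le> (arccos c)\<^sup>2"
    using cos_ge_one_minus_half_sq[of "arccos c"] assms by simp
  ultimately show ?thesis by linarith
qed

text \<open>Along a unit speed great circle the inner product with a fixed point \<open>q\<close> is a sinusoid
  \<open>h\<close> of amplitude at most \<open>1\<close>, so this computes the first two derivatives of the squared
  distance to \<open>q\<close>. The bounds on the second one are the Hessian comparison on the sphere: for
  \<open>r = arccos (h t)\<close> the eigenvalues of the Hessian of \<open>r\<^sup>2 / 2\<close> are \<open>1\<close> (towards \<open>q\<close>) and \<open>r cot r\<close>
  (perpendicular to it). If the amplitude is \<open>1\<close>, the great circle contains \<open>q\<close>, and the squared
  distance is just a squared parameter; otherwise \<open>\<bar>h\<bar> < 1\<close> and all functions can be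
  differentiated directly.\<close>

lemma sq_arccos_sinusoid_deriv:
  fixes A B t :: real
  defines "h \<equiv> \<lambda>s. A * cos s + B * sin s" and "h' \<equiv> \<lambda>s. B * cos s - A * sin s"
  assumes AB: "A\<^sup>2 + B\<^sup>2 \<le> 1" and gt: "-1 < h t"
  shows "((\<lambda>s. (arccos (h s))\<^sup>2) has_real_derivative - 2 * (arc_ratio (h t) * h' t)) (at t)"
    and "\<exists>D. ((\<lambda>s. - (arc_ratio (h s) * h' s)) has_real_derivative D) (at t) \<and>
          arc_ratio (h t) * h t \<le> D \<and> D \<le> 1"
proof -
  have sq: "(h s)\<^sup>2 + (h' s)\<^sup>2 = A\<^sup>2 + B\<^sup>2" for s
  proof -
    have "(h s)\<^sup>2 + (h' s)\<^sup>2 = (A\<^sup>2 + B\<^sup>2) * ((cos s)\<^sup>2 + (sin s)\<^sup>2)"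
      unfolding h_def h'_def by algebra
    then show ?thesis by simp
  qed
  have "((\<lambda>s. (arccos (h s))\<^sup>2) has_real_derivative - 2 * (arc_ratio (h t) * h' t)) (at t) \<and>
     (\<exists>D. ((\<lambda>s. - (arc_ratio (h s) * h' s)) has_real_derivative D) (at t) \<and>
          arc_ratio (h t) * h t \<le> D \<and> D \<le> 1)"
  proof (cases "A\<^sup>2 + B\<^sup>2 = 1")
    case True
    then have "(h t)\<^sup>2 + (- h' t)\<^sup>2 = 1" using sq[of t] by simp
    then obtain u where "h t = cos u" "- h' t = sin u" by (metis sincos_total_2pi)
    then obtain v where v: "h t = cos v" "h' t = - sin v" "-pi < v" "v \<le> pi"
      using sincos_principal_value[of u] by (metis minus_minus)
    have "v \<noteq> pi" using gt v by auto
    then have vpi: "v < pi" using v by simp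
    \<comment> \<open>\<open>h\<close> attains the value \<open>1\<close> at \<open>t - v\<close>, within half a period of \<open>t\<close>\<close>
    have h: "h s = cos (v + (s - t))" and h': "h' s = - sin (v + (s - t))" for s
    proof -
      have "h s = h t * cos (s - t) + h' t * sin (s - t)"
           "h' s = h' t * cos (s - t) - h t * sin (s - t)"
        unfolding h_def h'_def cos_diff sin_diff
        using sin_cos_squared_add[of t] by algebra+
      then show "h s = cos (v + (s - t))" "h' s = - sin (v + (s - t))"
        by (simp_all add: v cos_add sin_add)
    qed
    define S where "S = {t - v - pi <..< t - v + pi}"
    have S: "open S" "t \<in> S" using v vpi by (auto simp: S_def)
    have 1: "(arccos (h s))\<^sup>2 = (v + (s - t))\<^sup>2" if "s \<in> S" for s
    proof -
      have "\<bar>v + (s - t)\<bar> \<le> pi" using that by (auto simp: S_def)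
      then show ?thesis by (simp add: h arccos_cos_eq_abs)
    qed
    have 2: "- (arc_ratio (h s) * h' s) = v + (s - t)" if "s \<in> S" for s
    proof -
      define w where "w = v + (s - t)"
      have w: "\<bar>w\<bar> < pi" using that by (auto simp: S_def w_def)
      have "arc_ratio (cos w) * sin w = w"
      proof (cases "w = 0")
        case False
        then have "arc_ratio (cos \<bar>w\<bar>) = \<bar>w\<bar> / sin \<bar>w\<bar>"
          using w by (intro arc_ratio_cos) auto
        moreover have "sin w \<noteq> 0"
          using False w by (simp add: sin_zero_pi_iff)
        ultimately show ?thesis by (auto simp: abs_if split: if_splits)
      qed (simp add: arc_ratio_def)
      then show ?thesis by (simp add: h h' w_def)
    qed
    have d1: "((\<lambda>s. (v + (s - t))\<^sup>2) has_real_derivative 2 * v) (at t)"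
      by (auto intro!: derivative_eq_intros)
    have "((\<lambda>s. (arccos (h s))\<^sup>2) has_real_derivative 2 * v) (at t)"
      by (rule has_field_derivative_transform_within_open[OF d1 S]) (simp add: 1)
    moreover have d2: "((\<lambda>s. v + (s - t)) has_real_derivative 1) (at t)"
      by (auto intro!: derivative_eq_intros)
    have "((\<lambda>s. - (arc_ratio (h s) * h' s)) has_real_derivative 1) (at t)"
      by (rule has_field_derivative_transform_within_open[OF d2 S]) (simp add: 2)
    moreover have "arc_ratio (h t) * h t \<le> 1"
      using arc_ratio_bounds(2)[of "h t"] gt by (simp add: v)
    ultimately show ?thesis using 2[OF S(2)] by auto
  next
    case False
    have ht: "(h s)\<^sup>2 < 1" for s
      using sq[of s] False AB by (smt (verit) zero_le_power2)
    then have hb: "-1 < h s" "h s < 1" for s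
      using ht[of s] by (auto simp: power2_less_1_iff abs_if split: if_splits)
    have K: "arc_ratio (h s) = arccos (h s) / sqrt (1 - (h s)\<^sup>2)" for s
      using hb(2)[of s] by (simp add: arc_ratio_def)
    define r where "r = sqrt (1 - (h t)\<^sup>2)"
    have r: "0 < r" "r\<^sup>2 = 1 - (h t)\<^sup>2" using ht[of t] by (auto simp: r_def)
    have dh: "(h has_real_derivative h' s) (at s)" "(h' has_real_derivative - h s) (at s)" for s
      unfolding h_def h'_def by (auto intro!: derivative_eq_intros)
    have da: "((\<lambda>s. arccos (h s)) has_real_derivative - h' t / r) (at t)"
      using DERIV_chain2[OF DERIV_arccos[OF hb] dh(1)[of t]] by (simp add: r_def divide_inverse mult.commute)
    have dr: "((\<lambda>s. sqrt (1 - (h s)\<^sup>2)) has_real_derivative - h t * h' t / r) (at t)"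
      using ht[of t] by (auto intro!: derivative_eq_intros dh simp: r_def divide_simps)
    have m1: "((\<lambda>s. (arccos (h s))\<^sup>2) has_real_derivative - 2 * (arc_ratio (h t) * h' t)) (at t)"
      using r by (auto intro!: derivative_eq_intros hb dh(1) simp: K r_def[symmetric] field_simps)
    \<comment> \<open>\<open>q\<close> is the squared cosine of the angle between the great circle and the radial
      direction; it interpolates between the two eigenvalues\<close>
    define q where "q = (h' t)\<^sup>2 / r\<^sup>2"
    have "(h' t)\<^sup>2 \<le> r\<^sup>2" using sq[of t] AB r by simp
    then have q: "0 \<le> q" "q \<le> 1"
      using r(1) by (simp_all add: q_def)
    have "((\<lambda>s. arccos (h s) / sqrt (1 - (h s)\<^sup>2)) has_real_derivative
        ((- h' t / r) * r - arccos (h t) * (- h t * h' t / r)) / (r * r)) (at t)"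
      using DERIV_divide[OF da dr] r(1) by (simp add: r_def[symmetric])
    from DERIV_minus[OF DERIV_mult[OF this dh(2)]]
    have "((\<lambda>s. - (arccos (h s) / sqrt (1 - (h s)\<^sup>2) * h' s)) has_real_derivative
        - (((- h' t / r) * r - arccos (h t) * (- h t * h' t / r)) / (r * r) * h' t
           + - h t * (arccos (h t) / r))) (at t)"
      by (simp add: r_def[symmetric])
    also have "- (((- h' t / r) * r - arccos (h t) * (- h t * h' t / r)) / (r * r) * h' t
           + - h t * (arccos (h t) / r)) =
            arc_ratio (h t) * h t + q * (1 - arc_ratio (h t) * h t)"
      unfolding K q_def r_def[symmetric] using r(1) by (simp add: field_simps power2_eq_square)
    finally have "((\<lambda>s. - (arccos (h s) / sqrt (1 - (h s)\<^sup>2) * h' s)) has_real_derivative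
            arc_ratio (h t) * h t + q * (1 - arc_ratio (h t) * h t)) (at t)" .
    then have m2: "((\<lambda>s. - (arc_ratio (h s) * h' s)) has_real_derivative
            arc_ratio (h t) * h t + q * (1 - arc_ratio (h t) * h t)) (at t)"
      by (simp add: K)
    have m3: "arc_ratio (h t) * h t \<le> 1"
      using arc_ratio_bounds(2)[of "h t"] hb[of t] by simp
    define z where "z = 1 - arc_ratio (h t) * h t"
    have "0 \<le> z" using m3 by (simp add: z_def)
    then have z: "0 \<le> q * z" "q * z \<le> z"
      using q by (auto intro: mult_left_le_one_le)
    have "arc_ratio (h t) * h t \<le> arc_ratio (h t) * h t + q * z"
      "arc_ratio (h t) * h t + q * z \<le> 1"
      using z by (auto simp: z_def)
    then show ?thesis using m1 m2 unfolding z_def by blast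
  qed
  then show "((\<lambda>s. (arccos (h s))\<^sup>2) has_real_derivative - 2 * (arc_ratio (h t) * h' t)) (at t)"
    and "\<exists>D. ((\<lambda>s. - (arc_ratio (h s) * h' s)) has_real_derivative D) (at t) \<and>
          arc_ratio (h t) * h t \<le> D \<and> D \<le> 1"
    by auto
qed

section \<open>Distances and great circles on the sphere\<close>

lemma sph_dist_commute: "sph_dist p q = sph_dist q p"
  by (simp add: sph_dist_def inner_commute)

lemma abs_inner_unit_le: 
  fixes p q :: "'a::euclidean_space"
  assumes "norm p = 1" "norm q = 1"
  shows "-1 \<le> p \<bullet> q" "p \<bullet> q \<le> 1"
  using Cauchy_Schwarz_ineq2[of p q] assms by auto

lemma cos_sph_dist: "norm p = 1 \<Longrightarrow> norm q = 1 \<Longrightarrow> cos (sph_dist p q) = p \<bullet> q"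
  by (simp add: sph_dist_def abs_inner_unit_le)

lemma sph_dist_bounds:
  assumes "norm p = 1" "norm q = 1"
  shows "0 \<le> sph_dist p q" "sph_dist p q \<le> pi"
  using arccos_bounded[of "p \<bullet> q"] abs_inner_unit_le[OF assms] by (auto simp: sph_dist_def)

lemma inner_eq_one_unit:
  fixes p q :: "'a::euclidean_space"
  assumes "norm p = 1" "norm q = 1" "p \<bullet> q = 1"
  shows "p = q"
proof -
  have "(norm (p - q))\<^sup>2 = 0"
    using assms by (simp add: power2_norm_eq_inner inner_diff_left inner_diff_right inner_commute
      norm_eq_1)
  then show ?thesis by simp
qed

lemma sph_dist_self: "norm p = 1 \<Longrightarrow> sph_dist p p = 0"
  by (simp add: sph_dist_def norm_eq_1)

lemma sph_dist_eq_0: "norm p = 1 \<Longrightarrow> norm q = 1 \<Longrightarrow> sph_dist p q = 0 \<Longrightarrow> p = q"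
  using cos_sph_dist[of p q] inner_eq_one_unit[of p q] by simp

lemma bessel_two:
  fixes y v q :: "'a::euclidean_space"
  assumes "norm y = 1" "norm v = 1" "y \<bullet> v = 0" "norm q = 1"
  shows "(y \<bullet> q)\<^sup>2 + (v \<bullet> q)\<^sup>2 \<le> 1"
proof -
  have u: "y \<bullet> y = 1" "v \<bullet> v = 1" "q \<bullet> q = 1" "v \<bullet> y = 0"
    using assms by (auto simp: norm_eq_1 inner_commute)
  have "0 \<le> (q - (y \<bullet> q) *\<^sub>R y - (v \<bullet> q) *\<^sub>R v) \<bullet> (q - (y \<bullet> q) *\<^sub>R y - (v \<bullet> q) *\<^sub>R v)"
    by (rule inner_ge_zero)
  also have "\<dots> = 1 - (y \<bullet> q)\<^sup>2 - (v \<bullet> q)\<^sup>2"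
    using u assms(3)
    by (simp add: inner_diff_left inner_diff_right inner_commute power2_eq_square algebra_simps)
  finally show ?thesis by simp
qed

text \<open>For orthonormal \<open>y\<close>, \<open>v\<close> this is the unit speed geodesic from \<open>y\<close> in direction \<open>v\<close>; its
  velocity at \<open>t\<close> is \<open>great_circle v (- y) t\<close>.\<close>

definition great_circle :: "'a::real_vector \<Rightarrow> 'a \<Rightarrow> real \<Rightarrow> 'a" where
  "great_circle y v t = cos t *\<^sub>R y + sin t *\<^sub>R v"

lemma great_circle_0 [simp]: "great_circle y v 0 = y"
  by (simp add: great_circle_def)

lemma great_circle_inner:
  "great_circle y v t \<bullet> q = (y \<bullet> q) * cos t + (v \<bullet> q) * sin t"
  "great_circle v (- y) t \<bullet> q = (v \<bullet> q) * cos t - (y \<bullet> q) * sin t"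
  by (simp_all add: great_circle_def inner_add_left inner_diff_left mult.commute)

lemma great_circle_orthonormal:
  fixes y v :: "'a::euclidean_space"
  assumes "norm y = 1" "norm v = 1" "y \<bullet> v = 0"
  shows "norm (great_circle y v t) = 1" "norm (great_circle v (- y) t) = 1"
    "great_circle y v t \<bullet> great_circle v (- y) t = 0"
proof -
  have u: "y \<bullet> y = 1" "v \<bullet> v = 1" "v \<bullet> y = 0"
    using assms by (auto simp: norm_eq_1 inner_commute)
  show "norm (great_circle y v t) = 1" "norm (great_circle v (- y) t) = 1"
    "great_circle y v t \<bullet> great_circle v (- y) t = 0"
    using u assms(3) sin_cos_squared_add[of t] sin_cos_squared_add2[of t]
    by (simp_all add: great_circle_def norm_eq_1 inner_add_left inner_add_right
      power2_eq_square algebra_simps)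
qed

lemma sph_dist_great_circle:
  fixes y v :: "'a::euclidean_space"
  assumes "norm y = 1" "y \<bullet> v = 0" "\<bar>t\<bar> \<le> pi"
  shows "sph_dist y (great_circle y v t) = \<bar>t\<bar>"
  using assms
  by (simp add: sph_dist_def great_circle_def inner_add_right norm_eq_1 arccos_cos_eq_abs)

lemma great_circle_through:
  fixes y z :: "'a::euclidean_space"
  assumes "norm y = 1" "norm z = 1" "y \<noteq> z" "-1 < y \<bullet> z"
  obtains v where "norm v = 1" "y \<bullet> v = 0" "great_circle y v (sph_dist y z) = z"
proof -
  define c where "c = y \<bullet> z"
  have c: "-1 < c" "c < 1"
    using assms inner_eq_one_unit[of y z] abs_inner_unit_le[of y z] by (auto simp: c_def less_le)
  define s where "s = sqrt (1 - c\<^sup>2)"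
  have "c\<^sup>2 < 1" using c by (simp add: abs_square_less_1)
  then have s: "0 < s" "s\<^sup>2 = 1 - c\<^sup>2" by (auto simp: s_def)
  define v where "v = (1 / s) *\<^sub>R (z - c *\<^sub>R y)"
  have u: "y \<bullet> y = 1" "z \<bullet> z = 1" "z \<bullet> y = c" "y \<bullet> z = c"
    using assms by (auto simp: norm_eq_1 inner_commute c_def)
  have "(z - c *\<^sub>R y) \<bullet> (z - c *\<^sub>R y) = s\<^sup>2"
    using u s(2) by (simp add: inner_diff_left inner_diff_right power2_eq_square)
  then have "norm (z - c *\<^sub>R y) = s"
    using s(1) by (simp add: norm_eq_sqrt_inner)
  then have 1: "norm v = 1" using s(1) by (simp add: v_def)
  have 2: "y \<bullet> v = 0" using u by (simp add: v_def inner_diff_right)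
  have "great_circle y v (sph_dist y z) = c *\<^sub>R y + s *\<^sub>R v"
    using c by (simp add: great_circle_def sph_dist_def c_def[symmetric] sin_arccos s_def)
  also have "\<dots> = z" using s(1) by (simp add: v_def)
  finally show ?thesis using that[OF 1 2] by blast
qed

text \<open>Cauchy--Schwarz for the components of \<open>p\<close> and \<open>r\<close> orthogonal to \<open>q\<close> gives
  \<open>cos (a + b) \<le> p \<bullet> r\<close>, where \<open>a\<close> and \<open>b\<close> are the distances of \<open>p\<close> and \<open>r\<close> from \<open>q\<close>.\<close>

lemma sph_dist_triangle:
  fixes p q r :: "'a::euclidean_space"
  assumes "norm p = 1" "norm q = 1" "norm r = 1"
  shows "sph_dist p r \<le> sph_dist p q + sph_dist q r"
proof (cases "sph_dist p q + sph_dist q r \<le> pi")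
  case True
  define a b where "a = sph_dist p q" and "b = sph_dist q r"
  have ab: "0 \<le> a" "0 \<le> b" "a \<le> pi" "b \<le> pi"
    using assms sph_dist_bounds by (auto simp: a_def b_def)
  have u: "p \<bullet> p = 1" "q \<bullet> q = 1" "r \<bullet> r = 1" "p \<bullet> q = cos a" "q \<bullet> p = cos a"
    "q \<bullet> r = cos b" "r \<bullet> q = cos b"
    using assms by (auto simp: norm_eq_1 inner_commute a_def b_def cos_sph_dist)
  have "norm (p - cos a *\<^sub>R q) = sin a" "norm (r - cos b *\<^sub>R q) = sin b"
    using u ab sin_ge_zero[of a] sin_ge_zero[of b]
    by (auto simp: norm_eq_sqrt_inner inner_diff_left inner_diff_right real_sqrt_eq_iff
        sin_squared_eq[symmetric] power2_eq_square[symmetric])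
  then have "\<bar>(p - cos a *\<^sub>R q) \<bullet> (r - cos b *\<^sub>R q)\<bar> \<le> sin a * sin b"
    using Cauchy_Schwarz_ineq2[of "p - cos a *\<^sub>R q" "r - cos b *\<^sub>R q"] by simp
  moreover have "(p - cos a *\<^sub>R q) \<bullet> (r - cos b *\<^sub>R q) = p \<bullet> r - cos a * cos b"
    using u by (simp add: inner_diff_left inner_diff_right algebra_simps)
  ultimately have "cos (a + b) \<le> p \<bullet> r" by (simp add: cos_add abs_le_iff)
  then have "arccos (p \<bullet> r) \<le> arccos (cos (a + b))"
    using abs_inner_unit_le[of p r] assms by (intro arccos_le_arccos) auto
  then show ?thesis
    using True ab by (simp add: arccos_cos sph_dist_def a_def b_def)
next
  case False
  then show ?thesis using sph_dist_bounds[of p r] assms by linarith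
qed

lemma inner_ge_one_minus_sq:
  assumes "norm y = 1" "norm q = 1" "sph_dist y q \<le> r"
  shows "1 - r\<^sup>2 / 2 \<le> y \<bullet> q"
proof -
  have "(sph_dist y q)\<^sup>2 \<le> r\<^sup>2"
    using assms sph_dist_bounds(1)[of y q] by (intro power_mono) auto
  then show ?thesis
    using cos_ge_one_minus_half_sq[of "sph_dist y q"] cos_sph_dist[of y q] assms by linarith
qed

text \<open>Spherical caps of radius at most \<open>\<pi> / 2\<close> are convex: a point of the arc is a combination of
  its end points with nonnegative coefficients whose sum is at least \<open>1\<close>.\<close>

lemma inner_ge_along_arc:
  fixes y v q :: "'a::euclidean_space"
  assumes "0 \<le> t" "t \<le> L" "L < pi" "0 \<le> m"
    and "m \<le> y \<bullet> q" "m \<le> great_circle y v L \<bullet> q"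
  shows "m \<le> great_circle y v t \<bullet> q"
proof (cases "L = 0")
  case True
  then show ?thesis using assms by simp
next
  case False
  then have L: "0 < sin L" using assms by (intro sin_gt_zero) auto
  have s: "0 \<le> sin t" "0 \<le> sin (L - t)"
    using assms by (auto intro!: sin_ge_zero)
  have "sin L = sin (L - t) * cos t + cos (L - t) * sin t"
    using sin_add[of "L - t" t] by simp
  also have "\<dots> \<le> sin (L - t) * 1 + 1 * sin t"
    using s by (intro add_mono mult_left_mono mult_right_mono) auto
  finally have "m * sin L \<le> m * (sin (L - t) + sin t)"
    using assms(4) by (intro mult_left_mono) auto
  also have "\<dots> \<le> sin (L - t) * (y \<bullet> q) + sin t * (great_circle y v L \<bullet> q)"
    using mult_left_mono[OF assms(5) s(2)] mult_left_mono[OF assms(6) s(1)]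
    by (simp add: algebra_simps)
  also have "\<dots> = (great_circle y v t \<bullet> q) * sin L"
    unfolding great_circle_inner sin_diff by algebra
  finally show ?thesis using L by simp
qed

text \<open>For a unit tangent vector \<open>v\<close> at \<open>y\<close> this is \<open>v \<bullet> sph_log y q\<close>, that is (if \<open>q \<noteq> - y\<close>),
  minus half the derivative of the squared distance to \<open>q\<close> in direction \<open>v\<close>.\<close>

definition pull :: "'a::euclidean_space \<Rightarrow> 'a \<Rightarrow> 'a \<Rightarrow> real" where
  "pull y v q = arc_ratio (y \<bullet> q) * (v \<bullet> q)"

lemma abs_pull_le:
  fixes y v q :: "'a::euclidean_space"
  assumes "norm y = 1" "norm v = 1" "y \<bullet> v = 0" "norm q = 1" "-1 < y \<bullet> q"
  shows "\<bar>pull y v q\<bar> \<le> sph_dist y q"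
proof -
  have "(v \<bullet> q)\<^sup>2 \<le> 1 - (y \<bullet> q)\<^sup>2" using bessel_two[of y v q] assms by simp
  then have "\<bar>v \<bullet> q\<bar> \<le> sqrt (1 - (y \<bullet> q)\<^sup>2)" by (rule real_le_rsqrt[of "\<bar>v \<bullet> q\<bar>", simplified])
  moreover have K: "1 \<le> arc_ratio (y \<bullet> q)"
    "arc_ratio (y \<bullet> q) * sqrt (1 - (y \<bullet> q)\<^sup>2) = sph_dist y q"
    using arc_ratio_bounds[of "y \<bullet> q"] abs_inner_unit_le[of y q] assms by (auto simp: sph_dist_def)
  ultimately show ?thesis
    by (metis K(2) abs_ge_zero abs_mult abs_of_nonneg dual_order.trans mult_left_mono pull_def zero_le_one)
qed

lemma sq_dist_along_great_circle:
  fixes y v q :: "'a::euclidean_space"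
  assumes "norm y = 1" "norm v = 1" "y \<bullet> v = 0" "norm q = 1"
    and "-1 < great_circle y v t \<bullet> q"
  shows "((\<lambda>s. (sph_dist (great_circle y v s) q)\<^sup>2) has_real_derivative
      - 2 * pull (great_circle y v t) (great_circle v (- y) t) q) (at t)"
    and "\<exists>D. ((\<lambda>s. - pull (great_circle y v s) (great_circle v (- y) s) q)
            has_real_derivative D) (at t) \<and>
          arc_ratio (great_circle y v t \<bullet> q) * (great_circle y v t \<bullet> q) \<le> D \<and> D \<le> 1"
  using sq_arccos_sinusoid_deriv[OF bessel_two[OF assms(1-4)], of t] assms(5)
  unfolding sph_dist_def pull_def great_circle_inner by simp_all

section \<open>Critical points of the four-point cost\<close>

text \<open>The points are numbered along the sequence, so that \<open>q1\<close> and \<open>q2\<close> are the inner ones with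
  weight \<open>9 / 16\<close> and \<open>q0\<close> and \<open>q3\<close> the outer ones with weight \<open>- 1 / 16\<close>.\<close>

definition four_cost :: "'a::euclidean_space \<Rightarrow> 'a \<Rightarrow> 'a \<Rightarrow> 'a \<Rightarrow> 'a \<Rightarrow> real" where
  "four_cost q0 q1 q2 q3 y =
     (9 * (sph_dist y q1)\<^sup>2 + 9 * (sph_dist y q2)\<^sup>2 - (sph_dist y q0)\<^sup>2 - (sph_dist y q3)\<^sup>2) / 16"

definition four_pull :: "'a::euclidean_space \<Rightarrow> 'a \<Rightarrow> 'a \<Rightarrow> 'a \<Rightarrow> 'a \<Rightarrow> 'a \<Rightarrow> real" where
  "four_pull q0 q1 q2 q3 y v =
     (9 * pull y v q1 + 9 * pull y v q2 - pull y v q0 - pull y v q3) / 16"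

definition four_critical :: "'a::euclidean_space \<Rightarrow> 'a \<Rightarrow> 'a \<Rightarrow> 'a \<Rightarrow> 'a \<Rightarrow> bool" where
  "four_critical q0 q1 q2 q3 y \<longleftrightarrow> (\<forall>v. norm v = 1 \<longrightarrow> y \<bullet> v = 0 \<longrightarrow> four_pull q0 q1 q2 q3 y v = 0)"

context
  fixes q0 q1 q2 q3 :: "'a::euclidean_space"
  assumes q: "norm q0 = 1" "norm q1 = 1" "norm q2 = 1" "norm q3 = 1"
begin

lemma four_cost_deriv:
  assumes "norm y = 1" "norm v = 1" "y \<bullet> v = 0"
    and "\<And>p. p \<in> {q0, q1, q2, q3} \<Longrightarrow> -1 < great_circle y v t \<bullet> p"
  shows "((\<lambda>s. four_cost q0 q1 q2 q3 (great_circle y v s)) has_real_derivative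
      - 2 * four_pull q0 q1 q2 q3 (great_circle y v t) (great_circle v (- y) t)) (at t)"
proof -
  define f where "f p s = (sph_dist (great_circle y v s) p)\<^sup>2" for p s
  define g where "g p = - 2 * pull (great_circle y v t) (great_circle v (- y) t) p" for p
  have d: "(f p has_real_derivative g p) (at t)" if "p \<in> {q0, q1, q2, q3}" for p
    unfolding f_def g_def
    by (intro sq_dist_along_great_circle(1) assms) (use that q in auto)
  have "((\<lambda>s. (9 * f q1 s + 9 * f q2 s - f q0 s - f q3 s) / 16) has_real_derivative
      (9 * g q1 + 9 * g q2 - g q0 - g q3) / 16) (at t)"
    by (auto intro!: derivative_eq_intros d)
  then show ?thesis
    unfolding four_cost_def four_pull_def f_def g_def by (simp add: field_simps)
qed

text \<open>The derivative taken here is half the second derivative of the cost along the great circle. The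
  inner points contribute at least \<open>9 / 16 * m\<close> each, because \<open>r cot r \<ge> cos r\<close>; the outer
  ones, whose weights are negative, cost at most \<open>1 / 16\<close> each.\<close>

lemma four_pull_deriv:
  assumes "norm y = 1" "norm v = 1" "y \<bullet> v = 0"
    and gt: "\<And>p. p \<in> {q0, q1, q2, q3} \<Longrightarrow> -1 < great_circle y v t \<bullet> p"
    and m: "0 \<le> m" "m \<le> great_circle y v t \<bullet> q1" "m \<le> great_circle y v t \<bullet> q2"
  shows "\<exists>D. ((\<lambda>s. - four_pull q0 q1 q2 q3 (great_circle y v s) (great_circle v (- y) s))
      has_real_derivative D) (at t) \<and> (9 * m - 1) / 8 \<le> D"
proof -
  note d = sq_dist_along_great_circle(2)[OF assms(1-3)]
  define f where "f p s = - pull (great_circle y v s) (great_circle v (- y) s) p" for p s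
  have lower: "m \<le> arc_ratio (great_circle y v t \<bullet> p) * (great_circle y v t \<bullet> p)"
    if "p \<in> {q1, q2}" for p
  proof -
    have h: "m \<le> great_circle y v t \<bullet> p" using that m by auto
    have "1 \<le> arc_ratio (great_circle y v t \<bullet> p)"
      using h m(1) that q abs_inner_unit_le(2)[of "great_circle y v t" p]
        great_circle_orthonormal(1)[OF assms(1-3)]
      by (intro arc_ratio_bounds) auto
    then have "1 * (great_circle y v t \<bullet> p) \<le> arc_ratio (great_circle y v t \<bullet> p) * (great_circle y v t \<bullet> p)"
      using h m(1) by (intro mult_right_mono) auto
    then show ?thesis using h by simp
  qed
  obtain D0 where D0: "(f q0 has_real_derivative D0) (at t)" "D0 \<le> 1"
    using d[OF q(1) gt] by (auto simp: f_def[abs_def])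
  obtain D3 where D3: "(f q3 has_real_derivative D3) (at t)" "D3 \<le> 1"
    using d[OF q(4) gt] by (auto simp: f_def[abs_def])
  obtain D1 where D1: "(f q1 has_real_derivative D1) (at t)" "m \<le> D1"
    using d[OF q(2) gt] lower[of q1] by (force simp: f_def[abs_def])
  obtain D2 where D2: "(f q2 has_real_derivative D2) (at t)" "m \<le> D2"
    using d[OF q(3) gt] lower[of q2] by (force simp: f_def[abs_def])
  have "((\<lambda>s. (9 * f q1 s + 9 * f q2 s - f q0 s - f q3 s) / 16) has_real_derivative
      (9 * D1 + 9 * D2 - D0 - D3) / 16) (at t)"
    by (auto intro!: derivative_eq_intros D0 D1 D2 D3)
  moreover have "(9 * m - 1) / 8 \<le> (9 * D1 + 9 * D2 - D0 - D3) / 16"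
    using D0 D1 D2 D3 by (simp add: field_simps)
  moreover have "(\<lambda>s. (9 * f q1 s + 9 * f q2 s - f q0 s - f q3 s) / 16) =
      (\<lambda>s. - four_pull q0 q1 q2 q3 (great_circle y v s) (great_circle v (- y) s))"
    by (auto simp: f_def four_pull_def field_simps)
  ultimately show ?thesis by metis
qed

lemma four_pull_decrease:
  assumes "norm y = 1" "norm v = 1" "y \<bullet> v = 0" "0 \<le> L"
    and gt: "\<And>p t. p \<in> {q0, q1, q2, q3} \<Longrightarrow> 0 \<le> t \<Longrightarrow> t \<le> L \<Longrightarrow> -1 < great_circle y v t \<bullet> p"
    and m: "0 \<le> m" "\<And>t. 0 \<le> t \<Longrightarrow> t \<le> L \<Longrightarrow> m \<le> great_circle y v t \<bullet> q1"
      "\<And>t. 0 \<le> t \<Longrightarrow> t \<le> L \<Longrightarrow> m \<le> great_circle y v t \<bullet> q2"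
  shows "(9 * m - 1) / 8 * L \<le> four_pull q0 q1 q2 q3 y v
      - four_pull q0 q1 q2 q3 (great_circle y v L) (great_circle v (- y) L)"
proof -
  define f where "f s = - four_pull q0 q1 q2 q3 (great_circle y v s) (great_circle v (- y) s)" for s
  have "f 0 - (9 * m - 1) / 8 * 0 \<le> f L - (9 * m - 1) / 8 * L"
  proof (rule DERIV_nonneg_imp_nondecreasing[OF assms(4)])
    fix t assume t: "0 \<le> t" "t \<le> L"
    obtain D where D: "(f has_real_derivative D) (at t)" "(9 * m - 1) / 8 \<le> D"
      using four_pull_deriv[OF assms(1-3) gt m(1), of t] t m(2,3)[OF t] by (auto simp: f_def[abs_def])
    have "((\<lambda>t. f t - (9 * m - 1) / 8 * t) has_real_derivative D - (9 * m - 1) / 8) (at t)"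
      by (auto intro!: derivative_eq_intros D)
    then show "\<exists>E. ((\<lambda>t. f t - (9 * m - 1) / 8 * t) has_real_derivative E) (at t) \<and> 0 \<le> E"
      using D(2) by (intro exI conjI) auto
  qed
  then show ?thesis by (simp add: f_def)
qed

text \<open>The threshold \<open>1 / 9\<close> makes the convexity constant \<open>(9 * m - 1) / 8\<close> positive. As caps are
  convex, the cost is then strictly convex along the arc joining two critical points, which leaves
  no room for two zeros of its derivative.\<close>

lemma four_critical_unique:
  assumes "norm y = 1" "norm z = 1" and m: "1 / 9 < m"
    and y: "\<And>p. p \<in> {q0, q1, q2, q3} \<Longrightarrow> m \<le> y \<bullet> p"
    and z: "\<And>p. p \<in> {q0, q1, q2, q3} \<Longrightarrow> m \<le> z \<bullet> p"
    and "four_critical q0 q1 q2 q3 y" "four_critical q0 q1 q2 q3 z"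
  shows "y = z"
proof (rule ccontr)
  assume ne: "y \<noteq> z"
  have "y \<bullet> z \<noteq> -1"
  proof
    assume "y \<bullet> z = -1"
    then have "y = - z" using inner_eq_one_unit[of y "- z"] assms by simp
    then show False using y[of q0] z[of q0] m by auto
  qed
  then have gt: "-1 < y \<bullet> z" using abs_inner_unit_le(1)[of y z] assms by auto
  obtain v where v: "norm v = 1" "y \<bullet> v = 0" "great_circle y v (sph_dist y z) = z"
    using great_circle_through[OF assms(1,2) ne gt] .
  define L where "L = sph_dist y z"
  have L: "0 \<le> L" "L \<le> pi" "L \<noteq> 0" "cos L = y \<bullet> z"
    using sph_dist_bounds[of y z] sph_dist_eq_0[of y z] cos_sph_dist[of y z] ne assms
    by (auto simp: L_def)
  then have L_lt: "L < pi" using gt by (cases "L = pi") auto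
  have arc: "m \<le> great_circle y v t \<bullet> p" if "p \<in> {q0, q1, q2, q3}" "0 \<le> t" "t \<le> L" for p t
    using inner_ge_along_arc[OF that(2,3) L_lt _ y[OF that(1)]] z[OF that(1)] v(3) m
    by (simp add: L_def)
  have arc': "-1 < great_circle y v t \<bullet> p" if "p \<in> {q0, q1, q2, q3}" "0 \<le> t" "t \<le> L" for p t
    using arc[OF that] m by linarith
  have "(9 * m - 1) / 8 * L \<le> four_pull q0 q1 q2 q3 y v
      - four_pull q0 q1 q2 q3 (great_circle y v L) (great_circle v (- y) L)"
    using m by (intro four_pull_decrease assms v L arc arc') auto
  moreover have "four_pull q0 q1 q2 q3 y v = 0"
    using assms(6) v by (simp add: four_critical_def)
  moreover have "four_pull q0 q1 q2 q3 (great_circle y v L) (great_circle v (- y) L) = 0"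
    using assms(7) v(3) great_circle_orthonormal[OF assms(1) v(1,2), of L]
    by (simp add: four_critical_def L_def)
  moreover have "0 < (9 * m - 1) / 8 * L" using m L by simp
  ultimately show False by simp
qed

lemma four_critical_of_arg_min:
  assumes "norm p = 1" and min: "is_arg_min (four_cost q0 q1 q2 q3) (\<lambda>z. z \<in> sph_ball p R) y"
    and gt: "\<And>p. p \<in> {q0, q1, q2, q3} \<Longrightarrow> -1 < y \<bullet> p"
  shows "four_critical q0 q1 q2 q3 y"
  unfolding four_critical_def
proof (intro allI impI)
  fix v :: 'a assume v: "norm v = 1" "y \<bullet> v = 0"
  have y: "norm y = 1" "sph_dist p y < R"
    and le: "\<And>z. z \<in> sph_ball p R \<Longrightarrow> four_cost q0 q1 q2 q3 y \<le> four_cost q0 q1 q2 q3 z"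
    using min by (auto simp: is_arg_min_def sph_ball_def not_less)
  have "((\<lambda>s. four_cost q0 q1 q2 q3 (great_circle y v s)) has_real_derivative
      - 2 * four_pull q0 q1 q2 q3 (great_circle y v 0) (great_circle v (- y) 0)) (at 0)"
    by (intro four_cost_deriv y v) (use gt in auto)
  moreover have "\<forall>s. \<bar>0 - s\<bar> < min pi (R - sph_dist p y) \<longrightarrow>
      four_cost q0 q1 q2 q3 (great_circle y v 0) \<le> four_cost q0 q1 q2 q3 (great_circle y v s)"
  proof (intro allI impI)
    fix s :: real assume s: "\<bar>0 - s\<bar> < min pi (R - sph_dist p y)"
    have n: "norm (great_circle y v s) = 1"
      by (rule great_circle_orthonormal) (use y v in auto)
    have "sph_dist p (great_circle y v s) \<le> sph_dist p y + \<bar>s\<bar>"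
      using sph_dist_triangle[OF assms(1) y(1) n] sph_dist_great_circle[OF y(1) v(2), of s] s by simp
    then show "four_cost q0 q1 q2 q3 (great_circle y v 0) \<le> four_cost q0 q1 q2 q3 (great_circle y v s)"
      using s n by (auto intro!: le simp: sph_ball_def)
  qed
  ultimately have "- 2 * four_pull q0 q1 q2 q3 (great_circle y v 0) (great_circle v (- y) 0) = 0"
    using y(2) by (intro DERIV_local_min[where d="min pi (R - sph_dist p y)"]) auto
  then show "four_pull q0 q1 q2 q3 y v = 0" by simp
qed

text \<open>For critical \<open>y\<close> the tangential parts of the points balance if the point at distance \<open>r\<close>
  gets the extra factor \<open>r / sin r = 1 + O(r\<^sup>2)\<close>. Hence the affine combination \<open>s\<close> of the points in
  the ambient space has tangential part \<open>O(r\<^sup>2)\<close> at \<open>y\<close>; its normal part is \<open>1 - O(r\<^sup>2)\<close> since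
  \<open>cos r\<close> is.\<close>

lemma four_critical_error:
  assumes "norm y = 1" "four_critical q0 q1 q2 q3 y"
    and r: "\<And>p. p \<in> {q0, q1, q2, q3} \<Longrightarrow> sph_dist y p \<le> r" "r \<le> 1"
  shows "norm (y - (1 / 16) *\<^sub>R (9 *\<^sub>R q1 + 9 *\<^sub>R q2 - q0 - q3)) \<le> 2 * r\<^sup>2"
proof -
  define s where "s = (1 / 16) *\<^sub>R (9 *\<^sub>R q1 + 9 *\<^sub>R q2 - q0 - q3)"
  define w where "w = s - (s \<bullet> y) *\<^sub>R y"
  have r0: "0 \<le> r" using r(1)[of q0] sph_dist_bounds(1)[of y q0] assms(1) q by simp
  have c: "1 - r\<^sup>2 / 2 \<le> y \<bullet> p" "y \<bullet> p \<le> 1" if "p \<in> {q0, q1, q2, q3}" for p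
    using inner_ge_one_minus_sq[OF assms(1) _ r(1)[OF that]] abs_inner_unit_le(2)[of y p]
      that q assms(1) by auto
  have r2: "r\<^sup>2 \<le> 1" using r0 r(2) by (simp add: power_le_one)
  have K: "\<bar>1 - arc_ratio (y \<bullet> p)\<bar> \<le> r\<^sup>2" if "p \<in> {q0, q1, q2, q3}" for p
  proof -
    have "1 / 2 \<le> y \<bullet> p" using c(1)[OF that] r2 by linarith
    then have "arc_ratio (y \<bullet> p) - 1 \<le> (sph_dist y p)\<^sup>2" "1 \<le> arc_ratio (y \<bullet> p)"
      using c(2)[OF that] arc_ratio_le_square[of "y \<bullet> p"] arc_ratio_bounds(1)[of "y \<bullet> p"]
      by (auto simp: sph_dist_def)
    moreover have "(sph_dist y p)\<^sup>2 \<le> r\<^sup>2"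
      using r(1)[OF that] sph_dist_bounds(1)[of y p] assms(1) that q by (intro power_mono) auto
    ultimately show ?thesis by simp
  qed
  have "norm w \<le> 5 / 4 * r\<^sup>2"
  proof (cases "w = 0")
    case False
    define v where "v = (1 / norm w) *\<^sub>R w"
    have yw: "y \<bullet> w = 0"
      using assms(1) by (simp add: w_def inner_diff_right norm_eq_1 inner_commute)
    then have v: "norm v = 1" "y \<bullet> v = 0" "v \<bullet> y = 0"
      using False by (auto simp: v_def inner_commute)
    have "v \<bullet> w = norm w"
      using False by (simp add: v_def dot_square_norm power2_eq_square)
    moreover have "v \<bullet> w = v \<bullet> s" using v by (simp add: w_def inner_diff_right)
    moreover have "v \<bullet> s = (9 * (v \<bullet> q1) + 9 * (v \<bullet> q2) - v \<bullet> q0 - v \<bullet> q3) / 16"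
      by (simp add: s_def inner_add_right inner_diff_right)
    moreover have "four_pull q0 q1 q2 q3 y v = 0"
      using assms(2) v by (simp add: four_critical_def)
    define e where "e p = (1 - arc_ratio (y \<bullet> p)) * (v \<bullet> p)" for p
    ultimately have "norm w = (9 * e q1 + 9 * e q2 - e q0 - e q3) / 16"
      using \<open>four_pull q0 q1 q2 q3 y v = 0\<close>
      unfolding e_def by (simp add: four_pull_def pull_def algebra_simps)
    moreover have "\<bar>e p\<bar> \<le> r\<^sup>2" if "p \<in> {q0, q1, q2, q3}" for p
    proof -
      have "\<bar>v \<bullet> p\<bar> \<le> 1" using abs_inner_unit_le[of v p] v that q by auto
      then have "\<bar>e p\<bar> \<le> r\<^sup>2 * 1"
        unfolding e_def abs_mult using K[OF that] by (intro mult_mono) auto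
      then show ?thesis by simp
    qed
    then have "\<bar>e q0\<bar> \<le> r\<^sup>2" "\<bar>e q1\<bar> \<le> r\<^sup>2" "\<bar>e q2\<bar> \<le> r\<^sup>2" "\<bar>e q3\<bar> \<le> r\<^sup>2" by auto
    ultimately show ?thesis by (simp add: abs_le_iff)
  qed auto
  moreover have "\<bar>1 - s \<bullet> y\<bar> \<le> 5 / 8 * r\<^sup>2"
  proof -
    have "s \<bullet> y = (9 * (y \<bullet> q1) + 9 * (y \<bullet> q2) - y \<bullet> q0 - y \<bullet> q3) / 16"
      by (simp add: s_def inner_add_right inner_diff_right inner_commute[of _ y])
    then show ?thesis
      using c[of q0] c[of q1] c[of q2] c[of q3] zero_le_power2[of r] by (intro abs_leI) auto
  qed
  moreover have "norm (y - s) \<le> norm ((1 - s \<bullet> y) *\<^sub>R y) + norm w"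
  proof -
    have "y - s = (1 - s \<bullet> y) *\<^sub>R y - w" by (simp add: w_def algebra_simps)
    then show ?thesis by (simp only: norm_triangle_ineq4)
  qed
  moreover have "norm ((1 - s \<bullet> y) *\<^sub>R y) = \<bar>1 - s \<bullet> y\<bar>" using assms(1) by simp
  ultimately show ?thesis
    using zero_le_power2[of r] unfolding s_def[symmetric] by linarith
qed

end

section \<open>Existence and position of the minimiser\<close>

lemma sph_midpoint:
  fixes a b :: "'a::euclidean_space"
  assumes "norm a = 1" "norm b = 1" "-1 < a \<bullet> b"
  obtains p c where "norm p = 1" "sph_dist p a = sph_dist a b / 2" "sph_dist p b = sph_dist a b / 2"
    "a + b = c *\<^sub>R p"
proof -
  define \<theta> where "\<theta> = sph_dist a b"
  have \<theta>: "0 \<le> \<theta>" "\<theta> \<le> pi" "cos \<theta> = a \<bullet> b"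
    using sph_dist_bounds[of a b] cos_sph_dist[of a b] assms by (auto simp: \<theta>_def)
  then have lt: "\<theta> < pi" using assms(3) by (cases "\<theta> = pi") auto
  define n where "n = 2 * cos (\<theta> / 2)"
  have n: "0 < n" using \<theta> lt by (auto simp: n_def intro!: cos_gt_zero_pi)
  have c: "1 + a \<bullet> b = n * n / 2"
    using cos_double_cos[of "\<theta> / 2"] \<theta>(3) by (simp add: n_def power2_eq_square)
  define p where "p = (1 / n) *\<^sub>R (a + b)"
  have u: "a \<bullet> a = 1" "b \<bullet> b = 1" "b \<bullet> a = a \<bullet> b"
    using assms by (auto simp: norm_eq_1 inner_commute)
  have "(a + b) \<bullet> (a + b) = n * n" using u c by (simp add: inner_add_left inner_add_right)
  then have "norm (a + b) = n" using n by (simp add: norm_eq_sqrt_inner)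
  then have "norm p = 1" using n by (simp add: p_def)
  moreover have "p \<bullet> a = cos (\<theta> / 2)" "p \<bullet> b = cos (\<theta> / 2)"
    using u c n by (simp_all add: p_def inner_add_left n_def field_simps)
  then have "sph_dist p a = \<theta> / 2" "sph_dist p b = \<theta> / 2"
    unfolding sph_dist_def using \<theta> by (simp_all add: arccos_cos)
  moreover have "a + b = n *\<^sub>R p" using n by (simp add: p_def)
  ultimately show ?thesis using that by (auto simp: \<theta>_def)
qed

lemma continuous_on_four_cost:
  fixes q0 q1 q2 q3 :: "'a::euclidean_space"
  assumes "norm q0 = 1" "norm q1 = 1" "norm q2 = 1" "norm q3 = 1" "S \<subseteq> sphere 0 1"
  shows "continuous_on S (four_cost q0 q1 q2 q3)"
proof -
  have "continuous_on S (\<lambda>y. sph_dist y q)" if "norm q = 1" for q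
    unfolding sph_dist_def
    using assms(5) abs_inner_unit_le[of _ q] that
    by (intro continuous_on_arccos continuous_intros) auto
  note c = this[OF assms(1)] this[OF assms(2)] this[OF assms(3)] this[OF assms(4)]
  show ?thesis
    unfolding four_cost_def[abs_def] by (intro continuous_intros c) auto
qed

text \<open>A minimiser \<open>y\<close> over the closed ball about the midpoint \<open>p\<close> of the inner points exists by
  compactness; the claim is that it lies close to \<open>p\<close>, in particular in the open ball. On the
  geodesic from \<open>p\<close> to \<open>y\<close> the cost is strongly convex and does not increase at \<open>y\<close>, so the
  distance \<open>\<tau>\<close> of \<open>p\<close> and \<open>y\<close> is at most the downward slope at \<open>p\<close> divided by the convexity constant. At
  \<open>p\<close> the inner points cancel by symmetry, and the outer ones pull with at most
  \<open>1 / 16 * (3 / 2 * \<delta> + 3 / 2 * \<delta>)\<close>. Radius \<open>0.59\<close> yields a first bound on \<open>\<tau>\<close>, and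
  this bound a convexity constant close to \<open>1\<close>, hence \<open>\<tau> \<le> \<delta> / 5\<close>. Both inner points are at
  distance at most \<open>\<delta> / 2\<close> from \<open>p\<close>, which gives the contraction factor
  \<open>1 / 2 + 1 / 5 = 0.7\<close>.\<close>

lemma four_mean_exists:
  fixes q0 q1 q2 q3 :: "'a::euclidean_space"
  assumes q: "norm q0 = 1" "norm q1 = 1" "norm q2 = 1" "norm q3 = 1"
    and d: "sph_dist q0 q1 \<le> \<delta>" "sph_dist q1 q2 \<le> \<delta>" "sph_dist q2 q3 \<le> \<delta>" "\<delta> < 31 / 100"
  obtains p y where "norm p = 1" "norm y = 1"
    "\<And>u. u \<in> {q0, q1, q2, q3} \<Longrightarrow> sph_dist p u \<le> 3 / 2 * \<delta>"
    "sph_dist p y < 59 / 100"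
    "\<And>z. z \<in> sph_ball p (59 / 100) \<Longrightarrow> four_cost q0 q1 q2 q3 y \<le> four_cost q0 q1 q2 q3 z"
    "sph_dist y q1 \<le> 7 / 10 * \<delta>" "sph_dist y q2 \<le> 7 / 10 * \<delta>"
proof -
  have \<delta>0: "0 \<le> \<delta>" using sph_dist_bounds(1)[OF q(1,2)] d by linarith
  have "-1 < q1 \<bullet> q2"
    using inner_ge_one_minus_sq[OF q(2,3) d(2)] power_mono[of \<delta> "1" 2] \<delta>0 d(4) by simp
  then obtain p c where p: "norm p = 1" "sph_dist p q1 = sph_dist q1 q2 / 2"
    "sph_dist p q2 = sph_dist q1 q2 / 2" "q1 + q2 = c *\<^sub>R p"
    using sph_midpoint[OF q(2,3)] by blast
  have p12: "sph_dist p q1 \<le> \<delta> / 2" "sph_dist p q2 \<le> \<delta> / 2" using p d by auto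
  have pq: "sph_dist p u \<le> 3 / 2 * \<delta>" if "u \<in> {q0, q1, q2, q3}" for u
    using that p12 d sph_dist_triangle[OF p(1) q(2,1)] sph_dist_triangle[OF p(1) q(3,4)] \<delta>0
    by (auto simp: sph_dist_commute[of q1 q0])
  define C where "C = {z \<in> sphere 0 1. cos (59 / 100) \<le> p \<bullet> z}"
  have C: "z \<in> C \<longleftrightarrow> norm z = 1 \<and> sph_dist p z \<le> 59 / 100" for z
  proof -
    have "cos (59 / 100) \<le> p \<bullet> z \<longleftrightarrow> sph_dist p z \<le> 59 / 100" if "norm z = 1"
    proof -
      have "cos (59 / 100) \<le> cos (sph_dist p z) \<longleftrightarrow> sph_dist p z \<le> 59 / 100"
        using sph_dist_bounds[OF p(1) that] pi_gt3 by (intro cos_mono_le_eq) auto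
      then show ?thesis using cos_sph_dist[OF p(1) that] by simp
    qed
    then show ?thesis by (auto simp: C_def)
  qed
  have "C = sphere 0 1 \<inter> {z. cos (59 / 100) \<le> p \<bullet> z}" by (auto simp: C_def)
  then have "compact C"
    by (simp add: compact_Int_closed closed_Collect_le continuous_intros)
  moreover have "p \<in> C" using p(1) by (simp add: C sph_dist_self)
  moreover have "continuous_on C (four_cost q0 q1 q2 q3)"
    by (rule continuous_on_four_cost[OF q]) (auto simp: C_def)
  ultimately obtain y where y: "y \<in> C"
    and min: "\<And>z. z \<in> C \<Longrightarrow> four_cost q0 q1 q2 q3 y \<le> four_cost q0 q1 q2 q3 z"
    using continuous_attains_inf[of C] by blast
  define \<tau> where "\<tau> = sph_dist p y"
  have y1: "norm y = 1" and \<tau>: "0 \<le> \<tau>" "\<tau> \<le> 59 / 100"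
    using y sph_dist_bounds(1)[OF p(1), of y] by (auto simp: C \<tau>_def)
  have \<tau>_bound: "(9 * m - 1) / 8 * \<tau> \<le> 3 / 16 * \<delta>"
    if m: "0 \<le> m" "m \<le> 1 - (\<tau> + \<delta> / 2)\<^sup>2 / 2" for m
  proof (cases "y = p")
    case True
    then show ?thesis using \<delta>0 p(1) by (simp add: \<tau>_def sph_dist_self)
  next
    case False
    have pc: "cos \<tau> = p \<bullet> y" using cos_sph_dist[OF p(1) y1] by (simp add: \<tau>_def)
    have "0 < cos \<tau>" using \<tau> pi_gt3 by (intro cos_gt_zero_pi) auto
    then have "-1 < p \<bullet> y" using pc by simp
    then obtain v where v: "norm v = 1" "p \<bullet> v = 0" "great_circle p v \<tau> = y"
      using great_circle_through[OF p(1) y1] False unfolding \<tau>_def by metis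
    define z where "z t = great_circle p v t" for t
    have z: "norm (z t) = 1" for t
      unfolding z_def by (rule great_circle_orthonormal(1)[OF p(1) v(1,2)])
    have zp: "sph_dist (z t) p = t" if "0 \<le> t" "t \<le> \<tau>" for t
      using sph_dist_great_circle[OF p(1) v(2), of t] that \<tau> pi_gt3
      by (simp add: z_def sph_dist_commute[of _ p])
    have zq: "sph_dist (z t) u \<le> t + sph_dist p u" if "0 \<le> t" "t \<le> \<tau>" "norm u = 1" for t u
      using sph_dist_triangle[OF z p(1) that(3), of t] zp[OF that(1,2)] by simp
    have lower: "m \<le> z t \<bullet> u" if "0 \<le> t" "t \<le> \<tau>" "u \<in> {q1, q2}" for t u
    proof -
      have "norm u = 1" "sph_dist p u \<le> \<delta> / 2" using that(3) q p12 by auto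
      then have "1 - (\<tau> + \<delta> / 2)\<^sup>2 / 2 \<le> z t \<bullet> u"
        using zq[OF that(1,2)] that(2) by (intro inner_ge_one_minus_sq z) fastforce+
      then show ?thesis using m by linarith
    qed
    have gt: "-1 < z t \<bullet> u" if "0 \<le> t" "t \<le> \<tau>" "u \<in> {q0, q1, q2, q3}" for t u
    proof -
      have u: "norm u = 1" using that(3) q by auto
      have "sph_dist (z t) u \<le> 11 / 10"
        using zq[OF that(1,2) u] pq[OF that(3)] \<tau> that d(4) by linarith
      then have "1 - (11 / 10)\<^sup>2 / 2 \<le> z t \<bullet> u" by (intro inner_ge_one_minus_sq z u)
      then show ?thesis by (simp add: power2_eq_square)
    qed
    \<comment> \<open>moving from the minimiser back towards the centre does not lower the cost\<close>
    have "0 \<le> four_pull q0 q1 q2 q3 (z \<tau>) (great_circle v (- p) \<tau>)"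
    proof (rule ccontr)
      assume neg: "\<not> ?thesis"
      have deriv: "((\<lambda>s. four_cost q0 q1 q2 q3 (z s)) has_real_derivative
          - 2 * four_pull q0 q1 q2 q3 (z \<tau>) (great_circle v (- p) \<tau>)) (at \<tau>)"
        unfolding z_def by (intro four_cost_deriv q p v) (use gt[of \<tau>] \<tau> in \<open>auto simp: z_def\<close>)
      have pos: "0 < - 2 * four_pull q0 q1 q2 q3 (z \<tau>) (great_circle v (- p) \<tau>)"
        using neg by simp
      obtain e where e: "0 < e"
        "\<And>h. 0 < h \<Longrightarrow> h < e \<Longrightarrow> four_cost q0 q1 q2 q3 (z (\<tau> - h)) < four_cost q0 q1 q2 q3 (z \<tau>)"
        using DERIV_pos_inc_left[OF deriv pos] by blast
      have "0 < \<tau>" using \<tau> sph_dist_eq_0[OF p(1) y1] False by (auto simp: \<tau>_def less_le)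
      define h where "h = min (e / 2) \<tau>"
      have h: "0 < h" "h < e" "h \<le> \<tau>" using e(1) \<open>0 < \<tau>\<close> by (auto simp: h_def)
      have "z (\<tau> - h) \<in> C"
        using z zp[of "\<tau> - h"] h \<tau> by (auto simp: C sph_dist_commute[of p])
      then show False using min e(2)[OF h(1,2)] v(3) by (fastforce simp: z_def)
    qed
    moreover have "(9 * m - 1) / 8 * \<tau> \<le> four_pull q0 q1 q2 q3 p v
        - four_pull q0 q1 q2 q3 (great_circle p v \<tau>) (great_circle v (- p) \<tau>)"
      using gt lower m \<tau> by (intro four_pull_decrease q p v) (auto simp: z_def)
    moreover have "four_pull q0 q1 q2 q3 p v \<le> 3 / 16 * \<delta>"
    proof -
      have "v \<bullet> q1 + v \<bullet> q2 = 0"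
        using p(4) v(2) by (metis inner_add_right inner_commute inner_scaleR_right mult_zero_right)
      moreover have "p \<bullet> q1 = p \<bullet> q2"
        using cos_sph_dist[OF p(1) q(2)] cos_sph_dist[OF p(1) q(3)] p(2,3) by simp
      ultimately have "pull p v q1 + pull p v q2 = 0"
        by (simp add: pull_def flip: distrib_left)
      moreover have "\<bar>pull p v u\<bar> \<le> 3 / 2 * \<delta>" if "u \<in> {q0, q3}" for u
        using abs_pull_le[OF p(1) v(1,2), of u] gt[of 0 u] pq[of u] that q \<tau>(1) by (auto simp: z_def)
      then have "\<bar>pull p v q0\<bar> \<le> 3 / 2 * \<delta>" "\<bar>pull p v q3\<bar> \<le> 3 / 2 * \<delta>" by auto
      ultimately show ?thesis unfolding four_pull_def by (simp add: abs_le_iff)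
    qed
    ultimately show ?thesis unfolding z_def by linarith
  qed
  \<comment> \<open>\<open>0.745 = 0.59 + 0.31 / 2\<close>, and \<open>cos 0.745\<close> exceeds \<open>0.72\<close>\<close>
  have "(\<tau> + \<delta> / 2)\<^sup>2 \<le> (149 / 200)\<^sup>2" using \<tau> \<delta>0 d(4) by (intro power_mono) auto
  then have "137 / 200 * \<tau> \<le> 3 / 16 * \<delta>"
    using \<tau>_bound[of "18 / 25"] by (simp add: power2_eq_square)
  then have \<tau>2: "\<tau> \<le> 17 / 200" using d(4) by simp
  \<comment> \<open>by this bound the geodesic stays within \<open>0.085 + 0.31 / 2 = 0.24\<close> of the inner points,
    where the cosine exceeds \<open>0.971\<close>\<close>
  then have "(\<tau> + \<delta> / 2)\<^sup>2 \<le> (6 / 25)\<^sup>2" using \<tau> \<delta>0 d(4) by (intro power_mono) auto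
  then have "7739 / 8000 * \<tau> \<le> 3 / 16 * \<delta>"
    using \<tau>_bound[of "971 / 1000"] by (simp add: power2_eq_square)
  then have \<tau>3: "\<tau> \<le> 1 / 5 * \<delta>" using \<tau> \<delta>0 by simp
  have "sph_dist y u \<le> 7 / 10 * \<delta>" if "norm u = 1" "sph_dist p u \<le> \<delta> / 2" for u
    using sph_dist_triangle[OF y1 p(1) that(1)] that(2) \<tau>3
    by (simp add: \<tau>_def sph_dist_commute[of y p])
  then show ?thesis
    using p12 q \<tau>2 min C by (intro that[OF p(1) y1 pq]) (auto simp: \<tau>_def sph_ball_def)
qed

section \<open>One step of the Riemannian four-point rule\<close>

lemma sq_dist_sum_four_point_odd:
  "sq_dist_sum (four_point_mask (1 / 16)) x (2 * i + 1) =
     four_cost (x (i - 1)) (x i) (x (i + 1)) (x (i + 2))"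
proof
  fix y
  have "sq_dist_sum (four_point_mask (1 / 16)) x (2 * i + 1) y =
      linear_rule (four_point_mask (1 / 16)) (\<lambda>j. (sph_dist y (x j))\<^sup>2) (2 * i + 1)"
    by (simp add: sq_dist_sum_def linear_rule_def)
  also have "\<dots> = four_cost (x (i - 1)) (x i) (x (i + 1)) (x (i + 2)) y"
    by (simp only: linear_rule_four_point(2)) (simp add: four_cost_def field_simps)
  finally show "sq_dist_sum (four_point_mask (1 / 16)) x (2 * i + 1) y =
      four_cost (x (i - 1)) (x i) (x (i + 1)) (x (i + 2)) y" .
qed

lemma sq_dist_sum_four_point_even:
  "sq_dist_sum (four_point_mask \<omega>) x (2 * i) y = (sph_dist y (x i))\<^sup>2"
  unfolding sq_dist_sum_def four_point_mask_even_nonzero by (simp add: four_point_mask_def)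

lemma neg_part_four_point_odd:
  "neg_part (four_point_mask (1 / 16)) (2 * i + 1) = 1 / 8"
proof -
  have "{j. four_point_mask (1 / 16) (2 * i + 1 - 2 * j) < 0} = {i - 1, i + 2}"
    by (auto simp: four_point_mask_def split: if_splits)
  then show ?thesis by (simp add: neg_part_def four_point_mask_def)
qed

lemma neg_part_four_point_even: "neg_part (four_point_mask (1 / 16)) (2 * i) = 0"
proof -
  have "four_point_mask (1 / 16) (2 * i - 2 * j) \<ge> 0" for j
  proof (cases "j = i")
    case False
    then have "four_point_mask (1 / 16) (2 * i - 2 * j) = 0"
      using four_point_mask_even_nonzero[of "1 / 16" i] by blast
    then show ?thesis by simp
  qed (simp add: four_point_mask_def)
  then have "{j. four_point_mask (1 / 16) (2 * i - 2 * j) < 0} = {}"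
    by (auto simp: not_less)
  then show ?thesis by (simp add: neg_part_def)
qed

lemma four_cost_minimiser:
  fixes q0 q1 q2 q3 :: "'a::euclidean_space"
  assumes q: "norm q0 = 1" "norm q1 = 1" "norm q2 = 1" "norm q3 = 1" and p: "norm p = 1"
    and ball: "\<And>u. u \<in> {q0, q1, q2, q3} \<Longrightarrow> u \<in> sph_ball p \<rho>" and R: "\<rho> + R \<le> 27 / 25"
    and min: "is_arg_min (four_cost q0 q1 q2 q3) (\<lambda>z. z \<in> sph_ball p R) y"
  shows "norm y = 1" "four_critical q0 q1 q2 q3 y"
    "\<And>u. u \<in> {q0, q1, q2, q3} \<Longrightarrow> 2 / 5 \<le> y \<bullet> u"
proof -
  have y: "norm y = 1" "sph_dist p y < R"
    using min by (auto simp: is_arg_min_def sph_ball_def)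
  show 1: "2 / 5 \<le> y \<bullet> u" if u: "u \<in> {q0, q1, q2, q3}" for u
  proof -
    have u1: "norm u = 1" "sph_dist p u < \<rho>" using u ball[OF u] by (auto simp: sph_ball_def)
    have "sph_dist y u \<le> 27 / 25"
      using sph_dist_triangle[OF y(1) p u1(1)] y(2) u1(2) R by (simp add: sph_dist_commute[of y p])
    then have "1 - (27 / 25)\<^sup>2 / 2 \<le> y \<bullet> u" by (intro inner_ge_one_minus_sq y u1)
    then show ?thesis by (simp add: power2_eq_square)
  qed
  show "norm y = 1" by (rule y)
  have gt: "-1 < y \<bullet> u" if "u \<in> {q0, q1, q2, q3}" for u
    using 1[OF that] by linarith
  show "four_critical q0 q1 q2 q3 y" by (rule four_critical_of_arg_min[OF q p min gt])
qed

text \<open>Whichever \<open>p\<close>, \<open>\<rho>\<close>, \<open>\<rho>'\<close> are used, the admissibility conditions force \<open>\<rho>' < 3 / 5\<close> and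
  \<open>\<rho> < 4 / 5 * \<rho>'\<close>. So the four points have distance less than \<open>1.08\<close> from the minimiser, which
  places all possible minimisers in one region where critical points are unique: there the cosine
  of the distance is at least \<open>2 / 5 > 1 / 9\<close>.\<close>

lemma local_minimiser_odd_critical:
  fixes x :: "int \<Rightarrow> 'a::euclidean_space"
  assumes x: "\<And>i. norm (x i) = 1"
    and lm: "local_minimiser (four_point_mask (1 / 16)) x (2 * i + 1) y"
  shows "norm y = 1" "four_critical (x (i - 1)) (x i) (x (i + 1)) (x (i + 2)) y"
    "\<And>u. u \<in> {x (i - 1), x i, x (i + 1), x (i + 2)} \<Longrightarrow> 2 / 5 \<le> y \<bullet> u"
proof -
  obtain p \<rho> R where *: "norm p = 1"
    "\<forall>j. four_point_mask (1 / 16) (2 * i + 1 - 2 * j) \<noteq> 0 \<longrightarrow> x j \<in> sph_ball p \<rho>"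
    "(1 + 2 * (1 / 8)) * \<rho> < R" "R < pi / 4 * inverse (1 + (1 + pi / 2) * (1 / 8))"
    "{z. is_arg_min (four_cost (x (i - 1)) (x i) (x (i + 1)) (x (i + 2)))
       (\<lambda>z. z \<in> sph_ball p R) z} = {y}"
    using lm unfolding local_minimiser_def neg_part_four_point_odd sq_dist_sum_four_point_odd
      mem_sphere_0 by blast
  from *(5) have min: "is_arg_min (four_cost (x (i - 1)) (x i) (x (i + 1)) (x (i + 2)))
      (\<lambda>z. z \<in> sph_ball p R) y" by blast
  have ball: "u \<in> sph_ball p \<rho>" if "u \<in> {x (i - 1), x i, x (i + 1), x (i + 2)}" for u
    using that *(2)[rule_format, of "i - 1"] *(2)[rule_format, of i]
      *(2)[rule_format, of "i + 1"] *(2)[rule_format, of "i + 2"]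
    by (auto simp: four_point_mask_def)
  have "pi / 4 * inverse (1 + (1 + pi / 2) * (1 / 8)) \<le> 3 / 5"
    using pi_approx by (simp add: field_simps)
  then have "\<rho> + R \<le> 27 / 25" using *(3,4) by simp
  from four_cost_minimiser[OF x x x x *(1) ball this min]
  show "norm y = 1" "four_critical (x (i - 1)) (x i) (x (i + 1)) (x (i + 2)) y"
    "\<And>u. u \<in> {x (i - 1), x i, x (i + 1), x (i + 2)} \<Longrightarrow> 2 / 5 \<le> y \<bullet> u"
    by blast+
qed

text \<open>This is where the constant \<open>0.31\<close> comes from: the four points lie in the ball of radius
  \<open>\<rho> = 3 / 2 * 0.31 = 0.465\<close> about the midpoint, and with \<open>\<alpha>\<^sub>- = 1 / 8\<close> an admissible \<open>\<rho>'\<close> has to lie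
  strictly between \<open>5 / 4 * 0.465 = 0.58125\<close> and
  \<open>\<pi> / 4 / (1 + (1 + \<pi> / 2) / 8) \<approx> 0.594\<close>.\<close>

lemma local_minimiser_odd_exists:
  fixes x :: "int \<Rightarrow> 'a::euclidean_space"
  assumes x: "\<And>i. norm (x i) = 1" and d: "\<And>i. sph_dist (x i) (x (i + 1)) \<le> \<delta>" "\<delta> < 31 / 100"
  obtains y where "local_minimiser (four_point_mask (1 / 16)) x (2 * i + 1) y"
    "sph_dist y (x i) \<le> 7 / 10 * \<delta>" "sph_dist y (x (i + 1)) \<le> 7 / 10 * \<delta>"
proof -
  have d': "sph_dist (x (i - 1)) (x i) \<le> \<delta>" "sph_dist (x i) (x (i + 1)) \<le> \<delta>"
    "sph_dist (x (i + 1)) (x (i + 2)) \<le> \<delta>"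
    using d(1)[of "i - 1"] d(1)[of i] d(1)[of "i + 1"]
    by (simp_all add: add.commute)
  obtain p y where p: "norm p = 1" and y1: "norm y = 1"
    and near: "\<And>u. u \<in> {x (i - 1), x i, x (i + 1), x (i + 2)} \<Longrightarrow> sph_dist p u \<le> 3 / 2 * \<delta>"
    and y2: "sph_dist p y < 59 / 100"
    and le: "\<And>z. z \<in> sph_ball p (59 / 100) \<Longrightarrow>
        four_cost (x (i - 1)) (x i) (x (i + 1)) (x (i + 2)) y
        \<le> four_cost (x (i - 1)) (x i) (x (i + 1)) (x (i + 2)) z"
    and dist: "sph_dist y (x i) \<le> 7 / 10 * \<delta>" "sph_dist y (x (i + 1)) \<le> 7 / 10 * \<delta>"
    by (rule four_mean_exists[OF x x x x d' d(2)]) (rule that)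
  let ?min = "is_arg_min (four_cost (x (i - 1)) (x i) (x (i + 1)) (x (i + 2)))
      (\<lambda>z. z \<in> sph_ball p (59 / 100))"
  have "y \<in> sph_ball p (59 / 100)" using y1 y2 by (simp add: sph_ball_def)
  then have min: "?min y" using le by (auto simp: is_arg_min_def not_less)
  have ball: "u \<in> sph_ball p (93 / 200)" if "u \<in> {x (i - 1), x i, x (i + 1), x (i + 2)}" for u
    using near[OF that] d(2) that x by (auto simp: sph_ball_def)
  have "z = y" if "?min z" for z
    by (rule four_critical_unique[where m = "2 / 5", OF x x x x])
      (use four_cost_minimiser[OF x x x x p ball _ that] four_cost_minimiser[OF x x x x p ball _ min]
        in auto)
  then have "{z. ?min z} = {y}" using min by blast
  moreover have "(59 / 100::real) < pi / 4 * inverse (1 + (1 + pi / 2) * (1 / 8))"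
    using pi_approx by (simp add: field_simps)
  moreover have "x j \<in> sph_ball p (93 / 200)" if "four_point_mask (1 / 16) (2 * i + 1 - 2 * j) \<noteq> 0" for j
  proof -
    have "j \<in> {i - 1, i, i + 1, i + 2}"
      using four_point_mask_odd_nonzero[of "1 / 16" i] that by blast
    then show ?thesis by (intro ball) auto
  qed
  ultimately have "local_minimiser (four_point_mask (1 / 16)) x (2 * i + 1) y"
    unfolding local_minimiser_def neg_part_four_point_odd sq_dist_sum_four_point_odd
    using p by (intro exI[of _ p] exI[of _ "93 / 200"] exI[of _ "59 / 100"]) auto
  then show ?thesis using that dist by blast
qed

lemma local_minimiser_even:
  fixes x :: "int \<Rightarrow> 'a::euclidean_space"
  assumes x: "norm (x i) = 1"
  shows "local_minimiser (four_point_mask (1 / 16)) x (2 * i) y \<longleftrightarrow> y = x i"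
proof -
  have arg_min: "is_arg_min (sq_dist_sum (four_point_mask (1 / 16)) x (2 * i)) (\<lambda>z. z \<in> sph_ball p R) z
      \<longleftrightarrow> z = x i" if "x i \<in> sph_ball p R" for p R z
  proof
    assume "is_arg_min (sq_dist_sum (four_point_mask (1 / 16)) x (2 * i)) (\<lambda>z. z \<in> sph_ball p R) z"
    then have "norm z = 1" "\<not> (sph_dist (x i) (x i))\<^sup>2 < (sph_dist z (x i))\<^sup>2"
      using that by (auto simp: is_arg_min_def sph_ball_def sq_dist_sum_four_point_even)
    then show "z = x i" using x sph_dist_eq_0[of z "x i"] by (simp add: sph_dist_self)
  next
    assume "z = x i"
    then show "is_arg_min (sq_dist_sum (four_point_mask (1 / 16)) x (2 * i)) (\<lambda>z. z \<in> sph_ball p R) z"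
      using that x by (simp add: is_arg_min_def sq_dist_sum_four_point_even sph_dist_self not_less)
  qed
  have mask: "four_point_mask (1 / 16) (2 * i - 2 * j) \<noteq> 0 \<longleftrightarrow> j = i" for j
    using four_point_mask_even_nonzero[of "1 / 16" i] by blast
  show ?thesis
  proof
    assume "local_minimiser (four_point_mask (1 / 16)) x (2 * i) y"
    then obtain p \<rho> R where "x i \<in> sph_ball p \<rho>" "\<rho> < R"
      "is_arg_min (sq_dist_sum (four_point_mask (1 / 16)) x (2 * i)) (\<lambda>z. z \<in> sph_ball p R) y"
      unfolding local_minimiser_def mask by auto
    then show "y = x i" using arg_min[of p R y] by (auto simp: sph_ball_def)
  next
    assume "y = x i"
    have "x i \<in> sph_ball (x i) r" if "0 < r" for r
      using x that by (simp add: sph_ball_def sph_dist_self)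
    then show "local_minimiser (four_point_mask (1 / 16)) x (2 * i) y"
      unfolding local_minimiser_def mask neg_part_four_point_even
      using x arg_min[of "x i" "1 / 2"] \<open>y = x i\<close> pi_gt3
      by (intro exI[of _ "x i"] exI[of _ "1 / 4"] exI[of _ "1 / 2"]) auto
  qed
qed

text \<open>All that the convergence analysis has to know about one step on the sphere: it interpolates, it
  contracts the distances of neighbours, and it differs from the linear rule only to second order.\<close>

lemma riemannian_four_point_step:
  fixes x :: "int \<Rightarrow> 'a::euclidean_space"
  defines "T \<equiv> riemannian_rule (four_point_mask (1 / 16)) x"
  assumes x: "\<And>i. norm (x i) = 1" and d: "\<And>i. sph_dist (x i) (x (i + 1)) \<le> \<delta>" "\<delta> < 31 / 100"
  shows "riemannian_rule_defined (four_point_mask (1 / 16)) x"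
    and "T (2 * i) = x i" and "norm (T i) = 1" and "sph_dist (T i) (T (i + 1)) \<le> 7 / 10 * \<delta>"
    and "norm (T (2 * i + 1) - linear_rule (four_point_mask (1 / 16)) x (2 * i + 1)) \<le> 6 * \<delta>\<^sup>2"
proof -
  let ?a = "four_point_mask (1 / 16)"
  have \<delta>0: "0 \<le> \<delta>" using sph_dist_bounds(1)[OF x x, of 0 1] d(1)[of 0] by simp
  have odd: "y = z" if "local_minimiser ?a x (2 * i + 1) y" "local_minimiser ?a x (2 * i + 1) z" for i y z
    by (rule four_critical_unique[where m = "2 / 5", OF x x x x])
      (use local_minimiser_odd_critical[OF x that(1)] local_minimiser_odd_critical[OF x that(2)] in auto)
  have unique: "\<exists>!y. local_minimiser ?a x i y" for i
  proof (cases "even i")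
    case True
    then show ?thesis using local_minimiser_even[of x "i div 2"] x by auto
  next
    case False
    then obtain j where "i = 2 * j + 1" by (auto elim: oddE)
    then show ?thesis using local_minimiser_odd_exists[where x = x and \<delta> = \<delta> and i = j, OF x d] odd
      by metis
  qed
  then show "riemannian_rule_defined ?a x" by (simp add: riemannian_rule_defined_def)
  have T: "local_minimiser ?a x i (T i)" for i
    unfolding T_def riemannian_rule_def by (rule theI'[OF unique])
  show even: "T (2 * i) = x i" for i
    using T[of "2 * i"] local_minimiser_even[of x i, OF x] by blast
  have near: "sph_dist (T (2 * i + 1)) (x i) \<le> 7 / 10 * \<delta>"
    "sph_dist (T (2 * i + 1)) (x (i + 1)) \<le> 7 / 10 * \<delta>" for i
    using local_minimiser_odd_exists[where x = x and \<delta> = \<delta> and i = i, OF x d] odd[OF T]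
    by metis+
  note crit = local_minimiser_odd_critical[OF x T]
  show "norm (T i) = 1"
  proof (cases "even i")
    case True
    then show ?thesis using even x by auto
  next
    case False
    then show ?thesis using crit(1) by (auto elim: oddE)
  qed
  show "sph_dist (T i) (T (i + 1)) \<le> 7 / 10 * \<delta>"
  proof (cases "even i")
    case True
    then obtain j where j: "i = 2 * j" by (auto elim: evenE)
    show ?thesis using near(1)[of j] unfolding j even by (simp add: sph_dist_commute)
  next
    case False
    then obtain j where j: "i = 2 * j + 1" by (auto elim: oddE)
    have "T (i + 1) = x (j + 1)" using even[of "j + 1"] by (simp add: j algebra_simps)
    then show ?thesis using near(2)[of j] by (simp add: j)
  qed
  let ?y = "T (2 * i + 1)"
  \<comment> \<open>\<open>0.7 * \<delta>\<close> to the inner points, and one more \<open>\<delta>\<close> to the outer ones\<close>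
  have "sph_dist ?y u \<le> 17 / 10 * \<delta>" if u: "u \<in> {x (i - 1), x i, x (i + 1), x (i + 2)}" for u
  proof -
    have "sph_dist (x i) (x (i - 1)) \<le> \<delta>" "sph_dist (x (i + 1)) (x (i + 2)) \<le> \<delta>"
      using d(1)[of "i - 1"] d(1)[of "i + 1"] by (simp_all add: sph_dist_commute[of "x i"] add.commute)
    then show ?thesis
      using u near[of i] \<delta>0 sph_dist_triangle[of ?y "x i" "x (i - 1)", OF crit(1) x x]
        sph_dist_triangle[of ?y "x (i + 1)" "x (i + 2)", OF crit(1) x x] by auto
  qed
  then have "norm (?y - (1 / 16) *\<^sub>R (9 *\<^sub>R x i + 9 *\<^sub>R x (i + 1) - x (i - 1) - x (i + 2)))
      \<le> 2 * (17 / 10 * \<delta>)\<^sup>2"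
    by (intro four_critical_error[OF x x x x crit(1,2)]) (use d(2) in simp_all)
  also have "\<dots> \<le> 6 * \<delta>\<^sup>2"
    using zero_le_power2[of \<delta>] by (simp add: power_mult_distrib power_divide)
  also have "(1 / 16) *\<^sub>R (9 *\<^sub>R x i + 9 *\<^sub>R x (i + 1) - x (i - 1) - x (i + 2)) =
      linear_rule ?a x (2 * i + 1)"
    unfolding linear_rule_four_point
    by (rule euclidean_eqI) (simp add: inner_add_left inner_diff_left field_simps)
  finally show "norm (?y - linear_rule ?a x (2 * i + 1)) \<le> 6 * \<delta>\<^sup>2" .
qed

section \<open>Perturbed linear four-point subdivision\<close>

text \<open>Telescoping turns a geometric bound on consecutive differences into a geometric rate of
  convergence that is uniform in the parameter.\<close>

lemma geometric_uniform_limit: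
  fixes F :: "nat \<Rightarrow> 'b \<Rightarrow> 'a::banach"
  assumes step: "\<And>k t. norm (F (Suc k) t - F k t) \<le> C * q ^ k" and q: "0 \<le> q" "q < 1"
  obtains f where "\<And>k t. norm (F k t - f t) \<le> C / (1 - q) * q ^ k"
proof -
  define d where "d t k = F (Suc k) t - F k t" for t k
  define f where "f t = F 0 t + (\<Sum>k. d t k)" for t
  have geo: "(\<lambda>k. C * q ^ (k + n)) sums (C / (1 - q) * q ^ n)" for n
    using sums_mult[OF geometric_sums, of q "C * q ^ n"] q by (simp add: power_add mult_ac)
  have norm_summable: "summable (\<lambda>k. norm (d t k))" for t
    by (rule summable_comparison_test'[OF sums_summable[OF geo[of 0]], of 0])
      (use step in \<open>simp add: d_def\<close>)
  have "norm (F n t - f t) \<le> C / (1 - q) * q ^ n" for n t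
  proof -
    have "(\<Sum>k. d t k) = (\<Sum>k. d t (k + n)) + (\<Sum>k<n. d t k)"
      by (rule suminf_split_initial_segment[OF summable_norm_cancel[OF norm_summable]])
    moreover have "(\<Sum>k<n. d t k) = F n t - F 0 t"
      unfolding d_def by (rule sum_lessThan_telescope)
    ultimately have "norm (F n t - f t) = norm (\<Sum>k. d t (k + n))"
      by (simp add: f_def norm_minus_commute)
    also have "\<dots> \<le> (\<Sum>k. norm (d t (k + n)))"
      by (rule summable_norm)
        (simp add: summable_iff_shift[of "\<lambda>k. norm (d t k)" n] norm_summable)
    also have "\<dots> \<le> (\<Sum>k. C * q ^ (k + n))"
      using norm_summable[of t] step sums_summable[OF geo[of n]]
      by (intro suminf_le) (auto simp: d_def summable_iff_shift[of "\<lambda>k. norm (F (Suc k) t - F k t)" n])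
    also have "\<dots> = C / (1 - q) * q ^ n" using geo[of n] by (simp add: sums_iff)
    finally show ?thesis .
  qed
  then show ?thesis using that by blast
qed

lemma floor_double_cases:
  fixes t :: real
  shows "\<lfloor>t * 2 ^ Suc k\<rfloor> = 2 * \<lfloor>t * 2 ^ k\<rfloor> \<or> \<lfloor>t * 2 ^ Suc k\<rfloor> = 2 * \<lfloor>t * 2 ^ k\<rfloor> + 1"
proof -
  have "t * 2 ^ Suc k = 2 * (t * 2 ^ k)" by simp
  then show ?thesis by linarith
qed

lemma floor_dyadic_tendsto: "(\<lambda>k. of_int \<lfloor>t * 2 ^ k\<rfloor> / 2 ^ k) \<longlonglongrightarrow> (t::real)"
proof (rule real_tendsto_sandwich)
  have "t - (1 / 2) ^ k \<le> of_int \<lfloor>t * 2 ^ k\<rfloor> / 2 ^ k" for k :: nat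
  proof -
    have "t * 2 ^ k - 1 \<le> of_int \<lfloor>t * 2 ^ k\<rfloor>" by linarith
    then have "(t * 2 ^ k - 1) / 2 ^ k \<le> of_int \<lfloor>t * 2 ^ k\<rfloor> / 2 ^ k"
      by (intro divide_right_mono) auto
    then show ?thesis by (simp add: diff_divide_distrib power_one_over)
  qed
  then show "\<forall>\<^sub>F k in sequentially. t - (1 / 2) ^ k \<le> of_int \<lfloor>t * 2 ^ k\<rfloor> / 2 ^ k"
    by simp
  show "\<forall>\<^sub>F k in sequentially. of_int \<lfloor>t * 2 ^ k\<rfloor> / 2 ^ k \<le> t"
    by (intro always_eventually allI) (simp add: pos_divide_le_eq)
  have "(\<lambda>k. t - (1 / 2) ^ k) \<longlonglongrightarrow> t - 0"
    by (intro tendsto_intros LIMSEQ_power_zero) simp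
  then show "(\<lambda>k. t - (1 / 2) ^ k) \<longlonglongrightarrow> t" by simp
qed simp

text \<open>From here on \<open>X k\<close> is level \<open>k\<close> of an interpolatory scheme that follows the linear
  four-point rule up to errors \<open>O(0.49\<^sup>k)\<close> and whose neighbouring points are \<open>O(0.7\<^sup>k)\<close> apart. Both
  rates carry the same constant \<open>C\<close>.\<close>

context
  fixes X :: "nat \<Rightarrow> int \<Rightarrow> 'a::euclidean_space" and C :: real
  assumes even: "\<And>k i. X (Suc k) (2 * i) = X k i"
    and odd: "\<And>k i. norm (X (Suc k) (2 * i + 1)
        - linear_rule (four_point_mask (1 / 16)) (X k) (2 * i + 1)) \<le> C * (49 / 100) ^ k"
    and diff: "\<And>k i. norm (X k (i + 1) - X k i) \<le> C * (7 / 10) ^ k"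
begin

lemma C0: "0 \<le> C"
  using order_trans[OF norm_ge_zero diff[of 0 0]] by simp

definition second_diff :: "nat \<Rightarrow> int \<Rightarrow> 'a" where
  "second_diff k i = X k (i + 2) - 2 *\<^sub>R X k (i + 1) + X k i"

definition defect :: "nat \<Rightarrow> int \<Rightarrow> 'a" where
  "defect k i = X (Suc k) (2 * i + 1) - linear_rule (four_point_mask (1 / 16)) (X k) (2 * i + 1)"

lemma defect_le: "norm (defect k i) \<le> C * (49 / 100) ^ k"
  using odd by (simp add: defect_def)

lemma second_diff_step:
  "second_diff (Suc k) (2 * i) =
     (1 / 8) *\<^sub>R second_diff k (i - 1) + (1 / 8) *\<^sub>R second_diff k i - 2 *\<^sub>R defect k i"
  "second_diff (Suc k) (2 * i + 1) =
     (3 / 8) *\<^sub>R second_diff k i - (1 / 16) *\<^sub>R second_diff k (i - 1) - (1 / 16) *\<^sub>R second_diff k (i + 1)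
     + defect k i + defect k (i + 1)"
proof -
  have e: "X (Suc k) (2 * i + 2) = X k (i + 1)" using even[of k "i + 1"] by simp
  show "second_diff (Suc k) (2 * i) =
     (1 / 8) *\<^sub>R second_diff k (i - 1) + (1 / 8) *\<^sub>R second_diff k i - 2 *\<^sub>R defect k i"
    unfolding second_diff_def defect_def linear_rule_four_point e even
    by (rule euclidean_eqI) (simp add: inner_add_left inner_diff_left field_simps)
  have i: "2 * i + 1 + 2 = 2 * (i + 1) + 1" "2 * i + 1 + 1 = 2 * i + 2" "i + 1 - 1 = i"
    "i - 1 + 2 = i + 1" "i - 1 + 1 = i" "i + 1 + 1 = i + 2" "i + 1 + 2 = i + 3" by auto
  show "second_diff (Suc k) (2 * i + 1) =
     (3 / 8) *\<^sub>R second_diff k i - (1 / 16) *\<^sub>R second_diff k (i - 1) - (1 / 16) *\<^sub>R second_diff k (i + 1)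
     + defect k i + defect k (i + 1)"
    unfolding second_diff_def defect_def linear_rule_four_point i e
    by (rule euclidean_eqI) (simp add: inner_add_left inner_diff_left field_simps)
qed

text \<open>In the supremum norm the linear rule maps second differences with factor \<open>1 / 2\<close>, too large
  for smoothness. Counting those with even index twice lowers the factor to \<open>7 / 16\<close>: the new
  even ones have coefficients \<open>1 / 8, 1 / 8\<close>, and the large coefficient \<open>3 / 8\<close> of the new odd ones
  meets neighbours of opposite parity with weights \<open>1 / 16\<close> only. Since \<open>7 / 16 < 49 / 100\<close>, the
  constant \<open>40 * C\<close> also absorbs the defects.\<close>

lemma second_diff_decay:
  "norm (second_diff k (2 * i)) \<le> 20 * C * (49 / 100) ^ k \<and>
   norm (second_diff k (2 * i + 1)) \<le> 40 * C * (49 / 100) ^ k"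
proof (induction k arbitrary: i)
  case 0
  have "norm (second_diff 0 j) \<le> 2 * C" for j
  proof -
    have "second_diff 0 j = (X 0 (j + 1 + 1) - X 0 (j + 1)) - (X 0 (j + 1) - X 0 j)"
      by (simp add: second_diff_def scaleR_2 add.commute)
    then have "norm (second_diff 0 j) \<le> norm (X 0 (j + 1 + 1) - X 0 (j + 1)) + norm (X 0 (j + 1) - X 0 j)"
      by (simp only: norm_triangle_ineq4)
    then show ?thesis using diff[of 0 "j + 1"] diff[of 0 j] by simp
  qed
  from this[of "2 * i"] this[of "2 * i + 1"] C0 show ?case by auto
next
  case (Suc k)
  define M where "M = C * (49 / 100) ^ k"
  have M0: "0 \<le> M" using C0 by (simp add: M_def)
  have IH: "norm (second_diff k (2 * j)) \<le> 20 * M" "norm (second_diff k (2 * j + 1)) \<le> 40 * M" for j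
    using Suc[of j] by (simp_all add: M_def mult_ac)
  have all: "norm (second_diff k (i - 1)) + norm (second_diff k i) \<le> 60 * M \<and>
    3 / 8 * norm (second_diff k i) + 1 / 16 * norm (second_diff k (i - 1))
      + 1 / 16 * norm (second_diff k (i + 1)) \<le> 35 / 2 * M" for i
  proof (cases "even i")
    case True
    then obtain j where j: "i = 2 * j" by (auto elim: evenE)
    have "i - 1 = 2 * (j - 1) + 1" using j by simp
    then show ?thesis using IH(1)[of j] IH(2)[of "j - 1"] IH(2)[of j] M0 unfolding j by auto
  next
    case False
    then obtain j where j: "i = 2 * j + 1" by (auto elim: oddE)
    have "norm (second_diff k (i - 1)) \<le> 20 * M" "norm (second_diff k i) \<le> 40 * M"
      "norm (second_diff k (i + 1)) \<le> 20 * M"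
      using IH(1)[of j] IH(2)[of j] IH(1)[of "j + 1"] j by (simp_all add: add.commute)
    then show ?thesis by auto
  qed
  have d: "norm (defect k i) \<le> M" for i using defect_le by (simp add: M_def)
  have "norm (second_diff (Suc k) (2 * i)) \<le> 1 / 8 * norm (second_diff k (i - 1))
      + 1 / 8 * norm (second_diff k i) + 2 * norm (defect k i)"
    unfolding second_diff_step
    by (rule order_trans[OF norm_triangle_ineq4] add_mono order_trans[OF norm_triangle_ineq] | simp)+
  moreover have "norm (second_diff (Suc k) (2 * i + 1)) \<le> 3 / 8 * norm (second_diff k i)
      + 1 / 16 * norm (second_diff k (i - 1)) + 1 / 16 * norm (second_diff k (i + 1))
      + norm (defect k i) + norm (defect k (i + 1))"
    unfolding second_diff_step
    by (rule order_trans[OF norm_triangle_ineq4] add_mono order_trans[OF norm_triangle_ineq] | simp)+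
  ultimately have "norm (second_diff (Suc k) (2 * i)) \<le> 98 / 10 * M"
    "norm (second_diff (Suc k) (2 * i + 1)) \<le> 196 / 10 * M"
    using all[of i] d[of i] d[of "i + 1"] M0 by auto
  then show ?case by (simp add: M_def)
qed

lemma second_diff_le: "norm (second_diff k i) \<le> 40 * C * (49 / 100) ^ k"
proof (cases "even i")
  case True
  have "norm (second_diff k i) \<le> 20 * C * (49 / 100) ^ k"
    using True second_diff_decay[of k "i div 2"] by auto
  moreover have "0 \<le> C * (49 / 100) ^ k" using C0 by simp
  ultimately show ?thesis by simp
next
  case False
  then show ?thesis using second_diff_decay[of k "i div 2"] by (auto elim!: oddE)
qed

lemma insertion_near_midpoint:
  "norm (X (Suc k) (2 * i + 1) - (1 / 2) *\<^sub>R (X k i + X k (i + 1))) \<le> 6 * C * (49 / 100) ^ k"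
proof -
  have i: "i - 1 + 2 = i + 1" "i - 1 + 1 = i" by auto
  have "X (Suc k) (2 * i + 1) - (1 / 2) *\<^sub>R (X k i + X k (i + 1)) =
      defect k i - ((1 / 16) *\<^sub>R second_diff k (i - 1) + (1 / 16) *\<^sub>R second_diff k i)"
    unfolding second_diff_def defect_def linear_rule_four_point i
    by (rule euclidean_eqI) (simp add: inner_add_left inner_diff_left field_simps)
  also have "norm \<dots> \<le> norm (defect k i)
      + (1 / 16 * norm (second_diff k (i - 1)) + 1 / 16 * norm (second_diff k i))"
    by (rule order_trans[OF norm_triangle_ineq4] add_mono order_trans[OF norm_triangle_ineq] | simp)+
  finally show ?thesis
    using defect_le[of k i] second_diff_le[of k i] second_diff_le[of k "i - 1"] by simp
qed

text \<open>These divided differences converge to the derivative of the limit curve.\<close>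

definition slope :: "nat \<Rightarrow> int \<Rightarrow> 'a" where
  "slope k i = 2 ^ k *\<^sub>R (X k (i + 1) - X k i)"

text \<open>Refinement changes divided differences by \<open>2 ^ Suc k\<close> times the deviation of the inserted point
  from the midpoint, and \<open>2 * 49 / 100 < 1\<close>.\<close>

lemma slope_refine:
  "norm (slope (Suc k) (2 * i) - slope k i) \<le> 12 * C * (49 / 50) ^ k"
  "norm (slope (Suc k) (2 * i + 1) - slope k i) \<le> 12 * C * (49 / 50) ^ k"
proof -
  let ?e = "X (Suc k) (2 * i + 1) - (1 / 2) *\<^sub>R (X k i + X k (i + 1))"
  have e: "X (Suc k) (2 * i + 1 + 1) = X k (i + 1)" using even[of k "i + 1"] by (simp add: add.commute)
  have "slope (Suc k) (2 * i) - slope k i = 2 ^ Suc k *\<^sub>R ?e"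
    unfolding slope_def even by (rule euclidean_eqI) (simp add: inner_add_left inner_diff_left field_simps)
  moreover have "slope (Suc k) (2 * i + 1) - slope k i = - (2 ^ Suc k *\<^sub>R ?e)"
    unfolding slope_def e by (rule euclidean_eqI) (simp add: inner_add_left inner_diff_left field_simps)
  moreover have "norm (2 ^ Suc k *\<^sub>R ?e) \<le> 12 * C * (49 / 50) ^ k"
  proof -
    have "norm (2 ^ Suc k *\<^sub>R ?e) = 2 ^ Suc k * norm ?e"
      by (simp del: power_Suc)
    also have "\<dots> \<le> 2 ^ Suc k * (6 * C * (49 / 100) ^ k)"
      by (intro mult_left_mono insertion_near_midpoint) simp
    also have "\<dots> = 12 * C * (49 / 50) ^ k"
      using power_mult_distrib[of "2::real" "49 / 100" k] by simp
    finally show ?thesis .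
  qed
  ultimately show "norm (slope (Suc k) (2 * i) - slope k i) \<le> 12 * C * (49 / 50) ^ k"
    "norm (slope (Suc k) (2 * i + 1) - slope k i) \<le> 12 * C * (49 / 50) ^ k"
    by (simp_all only: norm_minus_cancel)
qed

lemma slope_neighbour: "norm (slope k (i + 1) - slope k i) \<le> 40 * C * (49 / 50) ^ k"
proof -
  have "slope k (i + 1) - slope k i = 2 ^ k *\<^sub>R second_diff k i"
    by (simp add: slope_def second_diff_def algebra_simps scaleR_2)
  moreover have "2 ^ k * norm (second_diff k i) \<le> 2 ^ k * (40 * C * (49 / 100) ^ k)"
    by (intro mult_left_mono second_diff_le) simp
  moreover have "2 ^ k * (40 * C * (49 / 100) ^ k) = 40 * C * (49 / 50) ^ k"
    using power_mult_distrib[of "2::real" "49 / 100" k] by simp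
  ultimately show ?thesis by simp
qed

lemma slope_limit:
  obtains g :: "real \<Rightarrow> 'a" where
    "\<And>k t. norm (slope k \<lfloor>t * 2 ^ k :: real\<rfloor> - g t) \<le> 600 * C * (49 / 50) ^ k"
    "\<And>m s t. \<bar>s - t\<bar> \<le> 1 / 2 ^ m \<Longrightarrow> norm (g s - g t) \<le> 1240 * C * (49 / 50) ^ m"
proof -
  have "norm (slope (Suc k) \<lfloor>t * 2 ^ Suc k\<rfloor> - slope k \<lfloor>t * 2 ^ k\<rfloor>) \<le> 12 * C * (49 / 50) ^ k" for k and t :: real
    using floor_double_cases[of t k] slope_refine[of k "\<lfloor>t * 2 ^ k\<rfloor>"] by (auto simp del: power_Suc)
  then obtain g where "\<And>k t. norm (slope k \<lfloor>t * 2 ^ k :: real\<rfloor> - g t) \<le> 12 * C / (1 - 49 / 50) * (49 / 50) ^ k"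
    using geometric_uniform_limit[of "\<lambda>k t. slope k \<lfloor>t * 2 ^ k\<rfloor>" "12 * C" "49 / 50"] by auto
  then have g: "norm (slope k \<lfloor>t * 2 ^ k\<rfloor> - g t) \<le> 600 * C * (49 / 50) ^ k" for k and t :: real
    by simp
  have mono: "norm (g s - g t) \<le> 1240 * C * (49 / 50) ^ m" if "s \<le> t" "t - s \<le> 1 / 2 ^ m" for m s t
  proof -
    have "t * 2 ^ m - s * 2 ^ m \<le> 1" using that(2) by (simp add: field_simps)
    moreover have "s * 2 ^ m \<le> t * 2 ^ m" using that(1) by simp
    ultimately have "\<lfloor>t * 2 ^ m\<rfloor> = \<lfloor>s * 2 ^ m\<rfloor> \<or> \<lfloor>t * 2 ^ m\<rfloor> = \<lfloor>s * 2 ^ m\<rfloor> + 1"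
      by linarith
    moreover have "0 \<le> 40 * C * (49 / 50) ^ m" using C0 by simp
    ultimately have n: "norm (slope m \<lfloor>t * 2 ^ m\<rfloor> - slope m \<lfloor>s * 2 ^ m\<rfloor>) \<le> 40 * C * (49 / 50) ^ m"
      using slope_neighbour by auto
    define p q r where "p = slope m \<lfloor>t * 2 ^ m\<rfloor> - g t" and "q = slope m \<lfloor>s * 2 ^ m\<rfloor> - g s"
      and "r = slope m \<lfloor>t * 2 ^ m\<rfloor> - slope m \<lfloor>s * 2 ^ m\<rfloor>"
    have "g s - g t = p - q - r" by (simp add: p_def q_def r_def)
    moreover have "norm (p - q - r) \<le> norm (p - q) + norm r" "norm (p - q) \<le> norm p + norm q"
      by (rule norm_triangle_ineq4)+
    moreover have "norm p \<le> 600 * C * (49 / 50) ^ m" "norm q \<le> 600 * C * (49 / 50) ^ m"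
      "norm r \<le> 40 * C * (49 / 50) ^ m"
      using g n by (simp_all add: p_def q_def r_def)
    ultimately show ?thesis by simp
  qed
  have "norm (g s - g t) \<le> 1240 * C * (49 / 50) ^ m" if "\<bar>s - t\<bar> \<le> 1 / 2 ^ m" for m s t
    using mono[of s t m] mono[of t s m] that by (cases "s \<le> t") (auto simp: norm_minus_commute)
  then show ?thesis using that g by blast
qed

lemma value_limit:
  obtains f :: "real \<Rightarrow> 'a" where "\<And>k t. norm (X k \<lfloor>t * 2 ^ k :: real\<rfloor> - f t) \<le> 10 / 3 * C * (7 / 10) ^ k"
proof -
  have "norm (X (Suc k) \<lfloor>t * 2 ^ Suc k\<rfloor> - X k \<lfloor>t * 2 ^ k\<rfloor>) \<le> C * (7 / 10) ^ k" for k and t :: real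
  proof -
    have "norm (X (Suc k) (2 * i + 1) - X k i) \<le> C * (7 / 10) ^ k" for i
    proof -
      have "norm (X (Suc k) (2 * i + 1) - X k i) \<le> C * (7 / 10) ^ Suc k"
        using diff[of "Suc k" "2 * i"] by (simp only: even)
      also have "\<dots> \<le> C * (7 / 10) ^ k" using C0 by (intro mult_left_mono) auto
      finally show ?thesis .
    qed
    then show ?thesis
      using floor_double_cases[of t k] C0 even by (auto simp del: power_Suc)
  qed
  then obtain f where "\<And>k t. norm (X k \<lfloor>t * 2 ^ k :: real\<rfloor> - f t) \<le> C / (1 - 7 / 10) * (7 / 10) ^ k"
    using geometric_uniform_limit[of "\<lambda>k t. X k \<lfloor>t * 2 ^ k\<rfloor>" C "7 / 10"] by auto
  then show ?thesis using that[of f] by (simp add: field_simps)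
qed

text \<open>At level \<open>k\<close> the difference of two values is a sum of steps \<open>slope k l / 2 ^ k\<close>, each of which
  is close to \<open>g s / 2 ^ k\<close>; the claim follows for \<open>k \<rightarrow> \<infinity>\<close>.\<close>

lemma secant_near_slope:
  assumes f: "\<And>k t. norm (X k \<lfloor>t * 2 ^ k :: real\<rfloor> - f t) \<le> 10 / 3 * C * (7 / 10) ^ k"
    and g: "\<And>k t. norm (slope k \<lfloor>t * 2 ^ k :: real\<rfloor> - g t) \<le> 600 * C * (49 / 50) ^ k"
    and g_mod: "\<And>m s t. \<bar>s - t\<bar> \<le> 1 / 2 ^ m \<Longrightarrow> norm (g s - g t) \<le> 1240 * C * (49 / 50) ^ m"
    and st: "s \<le> t" "t - s \<le> 1 / 2 ^ m"
  shows "norm (f t - f s - (t - s) *\<^sub>R g s) \<le> (t - s) * (1240 * C * (49 / 50) ^ m)"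
proof -
  define a where "a k = \<lfloor>s * 2 ^ k\<rfloor>" for k
  define b where "b k = \<lfloor>t * 2 ^ k\<rfloor>" for k
  define h where "h k = (of_int (b k) / 2 ^ k - of_int (a k) / 2 ^ k :: real)" for k :: nat
  define B where "B k = 600 * C * (49 / 50) ^ k + 1240 * C * (49 / 50) ^ m" for k
  have bound: "norm (X k (b k) - X k (a k) - h k *\<^sub>R g s) \<le> h k * B k" if k: "m \<le> k" for k
  proof -
    have ab: "a k \<le> b k" unfolding a_def b_def using st(1) by (intro floor_mono) simp
    have "norm (X k j - X k (a k) - (of_int (j - a k) / 2 ^ k) *\<^sub>R g s) \<le> of_int (j - a k) / 2 ^ k * B k"
      if "a k \<le> j" "j \<le> b k" for j
      using that
    proof (induction j rule: int_ge_induct)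
      case base
      then show ?case by simp
    next
      case (step l)
      define u where "u = of_int l / (2::real) ^ k"
      have u: "\<lfloor>u * 2 ^ k\<rfloor> = l" by (simp add: u_def)
      have "\<bar>u - s\<bar> \<le> 1 / 2 ^ m"
      proof -
        have "of_int l \<le> t * 2 ^ k" using step by (simp add: b_def le_floor_iff)
        then have "u \<le> t" by (simp add: u_def field_simps)
        moreover have "s * 2 ^ k - 1 \<le> of_int l" using step(1) unfolding a_def by linarith
        then have "(s * 2 ^ k - 1) / 2 ^ k \<le> u"
          unfolding u_def by (intro divide_right_mono) auto
        then have "s - 1 / 2 ^ k \<le> u" by (simp add: diff_divide_distrib)
        moreover have "1 / (2::real) ^ k \<le> 1 / 2 ^ m"
          using k by (intro divide_left_mono) (auto intro: power_increasing)
        ultimately show ?thesis using st by (simp add: abs_le_iff)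
      qed
      then have "norm (slope k l - g s) \<le> B k"
        using norm_triangle_le[OF add_mono[OF g[of k u] g_mod[of u s m]]]
        unfolding u B_def by simp
      moreover have "X k (l + 1) - X k l - (1 / 2 ^ k) *\<^sub>R g s = (1 / 2 ^ k) *\<^sub>R (slope k l - g s)"
        by (simp add: slope_def scaleR_diff_right)
      ultimately have "norm (X k (l + 1) - X k l - (1 / 2 ^ k) *\<^sub>R g s) \<le> 1 / 2 ^ k * B k"
        by (simp add: divide_right_mono)
      moreover have "norm (X k l - X k (a k) - (of_int (l - a k) / 2 ^ k) *\<^sub>R g s)
          \<le> of_int (l - a k) / 2 ^ k * B k"
        using step by simp
      ultimately have "norm ((X k l - X k (a k) - (of_int (l - a k) / 2 ^ k) *\<^sub>R g s)
          + (X k (l + 1) - X k l - (1 / 2 ^ k) *\<^sub>R g s))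
          \<le> of_int (l - a k) / 2 ^ k * B k + 1 / 2 ^ k * B k"
        by (intro norm_triangle_le add_mono)
      also have "of_int (l - a k) / 2 ^ k * B k + 1 / 2 ^ k * B k = of_int (l + 1 - a k) / 2 ^ k * B k"
        by (simp add: add_divide_distrib diff_divide_distrib algebra_simps)
      also have "(X k l - X k (a k) - (of_int (l - a k) / 2 ^ k) *\<^sub>R g s)
          + (X k (l + 1) - X k l - (1 / 2 ^ k) *\<^sub>R g s) =
          X k (l + 1) - X k (a k) - (of_int (l + 1 - a k) / 2 ^ k) *\<^sub>R g s"
        by (simp add: add_divide_distrib diff_divide_distrib algebra_simps)
      finally show ?case .
    qed
    from this[OF ab order_refl] show ?thesis by (simp add: h_def diff_divide_distrib)
  qed
  have lim_f: "(\<lambda>k. X k \<lfloor>u * 2 ^ k\<rfloor>) \<longlonglongrightarrow> f u" for u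
  proof (rule Lim_null_comparison[THEN LIM_zero_cancel])
    show "\<forall>\<^sub>F k in sequentially. norm (X k \<lfloor>u * 2 ^ k\<rfloor> - f u) \<le> 10 / 3 * C * (7 / 10) ^ k"
      using f by simp
    show "(\<lambda>k. 10 / 3 * C * (7 / 10) ^ k) \<longlonglongrightarrow> 0"
      by (intro tendsto_mult_right_zero LIMSEQ_power_zero) simp
  qed
  have lim_h: "h \<longlonglongrightarrow> t - s"
    unfolding h_def[abs_def] a_def b_def by (intro tendsto_diff floor_dyadic_tendsto)
  have "B \<longlonglongrightarrow> 0 + 1240 * C * (49 / 50) ^ m"
    unfolding B_def[abs_def]
    by (intro tendsto_add tendsto_const tendsto_mult_right_zero LIMSEQ_power_zero) simp
  then have upper: "(\<lambda>k. h k * B k) \<longlonglongrightarrow> (t - s) * (1240 * C * (49 / 50) ^ m)"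
    using tendsto_mult[OF lim_h] by fastforce
  have lower: "(\<lambda>k. norm (X k (b k) - X k (a k) - h k *\<^sub>R g s)) \<longlonglongrightarrow> norm (f t - f s - (t - s) *\<^sub>R g s)"
    unfolding a_def b_def by (intro tendsto_intros lim_f lim_h)
  show ?thesis
    by (rule LIMSEQ_le[OF lower upper]) (use bound in blast)
qed

text \<open>The secant estimate makes the uniform limit of the slopes the derivative of the limit curve.\<close>

lemma perturbed_four_point_C1:
  obtains f :: "real \<Rightarrow> 'a" where "\<And>k t. norm (X k \<lfloor>t * 2 ^ k :: real\<rfloor> - f t) \<le> 10 / 3 * C * (7 / 10) ^ k"
    "f C1_differentiable_on UNIV"
proof -
  obtain f where f: "\<And>k t. norm (X k \<lfloor>t * 2 ^ k :: real\<rfloor> - f t) \<le> 10 / 3 * C * (7 / 10) ^ k"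
    using value_limit by blast
  obtain g where g: "\<And>k t. norm (slope k \<lfloor>t * 2 ^ k :: real\<rfloor> - g t) \<le> 600 * C * (49 / 50) ^ k"
    and g_mod: "\<And>m s t. \<bar>s - t\<bar> \<le> 1 / 2 ^ m \<Longrightarrow> norm (g s - g t) \<le> 1240 * C * (49 / 50) ^ m"
    using slope_limit by blast
  note secant = secant_near_slope[OF f g g_mod]
  have small: "\<exists>m. 2480 * C * (49 / 50) ^ m < e" if "0 < e" for e
  proof -
    have "(\<lambda>m. 2480 * C * (49 / 50) ^ m) \<longlonglongrightarrow> 0"
      by (intro tendsto_mult_right_zero LIMSEQ_power_zero) simp
    then have "\<forall>\<^sub>F m in sequentially. 2480 * C * (49 / 50) ^ m < e"
      using that by (rule order_tendstoD)
    then show ?thesis by (auto simp: eventually_sequentially)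
  qed
  have "(f has_vector_derivative g s) (at s)" for s
    unfolding has_vector_derivative_def has_derivative_at_alt
  proof (intro conjI allI impI)
    show "bounded_linear (\<lambda>x. x *\<^sub>R g s)" by (rule bounded_linear_scaleR_left)
    fix e :: real assume "0 < e"
    then obtain m where m: "2480 * C * (49 / 50) ^ m < e" using small by blast
    define b where "b = 1240 * C * (49 / 50) ^ m"
    have b: "0 \<le> b" "2 * b \<le> e" using m C0 by (simp_all add: b_def)
    have "norm (f t - f s - (t - s) *\<^sub>R g s) \<le> e * norm (t - s)" if "norm (t - s) < 1 / 2 ^ m" for t
    proof (cases "s \<le> t")
      case True
      then have "norm (f t - f s - (t - s) *\<^sub>R g s) \<le> (t - s) * b"
        using secant[of s t m] that by (simp add: b_def)
      also have "\<dots> \<le> (t - s) * e" using b True by (intro mult_left_mono) auto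
      finally show ?thesis using True by (simp add: mult.commute)
    next
      case False
      then have 1: "norm (f s - f t - (s - t) *\<^sub>R g t) \<le> (s - t) * b"
        using secant[of t s m] that by (simp add: b_def)
      have 2: "norm ((s - t) *\<^sub>R (g t - g s)) \<le> (s - t) * b"
        using g_mod[of t s m] that False by (auto simp: b_def intro!: mult_left_mono)
      have "f t - f s - (t - s) *\<^sub>R g s = - ((f s - f t - (s - t) *\<^sub>R g t) + (s - t) *\<^sub>R (g t - g s))"
        by (simp add: algebra_simps)
      then have "norm (f t - f s - (t - s) *\<^sub>R g s) \<le> (s - t) * b + (s - t) * b"
        using norm_triangle_mono[OF 1 2] by (metis norm_minus_cancel)
      also have "\<dots> = (s - t) * (2 * b)" by simp
      also have "\<dots> \<le> (s - t) * e" using b False by (intro mult_left_mono) auto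
      finally show ?thesis using False by (simp add: mult.commute)
    qed
    then show "\<exists>d>0. \<forall>y. norm (y - s) < d \<longrightarrow> norm (f y - f s - (y - s) *\<^sub>R g s) \<le> e * norm (y - s)"
      by (intro exI[of _ "1 / 2 ^ m"]) auto
  qed
  moreover have "continuous_on UNIV g"
    unfolding continuous_on_iff
  proof (intro ballI allI impI)
    fix s e :: real assume "0 < e"
    then obtain m where m: "2480 * C * (49 / 50) ^ m < e" using small by blast
    have "0 \<le> C * (49 / 50) ^ m" using C0 by simp
    then have "dist (g t) (g s) < e" if "dist t s < 1 / 2 ^ m" for t
      using g_mod[of t s m] that m by (simp add: dist_norm)
    then show "\<exists>d>0. \<forall>t\<in>UNIV. dist t s < d \<longrightarrow> dist (g t) (g s) < e"
      by (intro exI[of _ "1 / 2 ^ m"]) auto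
  qed
  ultimately show ?thesis using that f unfolding C1_differentiable_on_def by blast
qed

end

section \<open>Convergence on the sphere\<close>

lemma norm_sph_exp_diff_le:
  assumes "norm p = 1"
  shows "norm (sph_exp p v - p) \<le> 2 * norm v"
proof -
  let ?r = "norm v"
  have "1 - cos ?r \<le> ?r"
  proof (cases "?r \<le> 2")
    case True
    then have "?r\<^sup>2 / 2 \<le> ?r"
      using mult_left_mono[of ?r 2 ?r] by (simp add: power2_eq_square)
    then show ?thesis using cos_ge_one_minus_half_sq[of ?r] by linarith
  next
    case False
    then show ?thesis using cos_ge_minus_one[of ?r] by linarith
  qed
  then have 1: "norm ((cos ?r - 1) *\<^sub>R p) \<le> ?r" using assms cos_le_one[of ?r] by simp
  have 2: "norm ((sin ?r / ?r) *\<^sub>R v) \<le> ?r"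
    using abs_sin_x_le_abs_x[of ?r] by (cases "v = 0") auto
  have "sph_exp p v - p = (cos ?r - 1) *\<^sub>R p + (sin ?r / ?r) *\<^sub>R v"
    by (simp add: sph_exp_def algebra_simps)
  then show ?thesis using norm_triangle_mono[OF 1 2] by simp
qed

text \<open>The interpolant stays close to the data, so it has the same uniform limit as the step function
  through them.\<close>

lemma chart_interpolation_near:
  fixes X :: "int \<Rightarrow> 'a::euclidean_space"
  assumes X: "\<And>i. norm (X i) = 1" and d: "\<And>i. sph_dist (X i) (X (i + 1)) \<le> \<delta>"
  shows "norm (chart_interpolation k X t - X \<lfloor>t * 2 ^ k\<rfloor>) \<le> 2 * \<delta>"
proof -
  define i where "i = \<lfloor>t * 2 ^ k\<rfloor>"
  define s where "s = t * 2 ^ k - of_int i"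
  have s: "0 \<le> s" "s \<le> 1" unfolding s_def i_def by linarith+
  have log: "norm (sph_log (X i) (X (i + 1))) \<le> \<delta>"
  proof -
    have "0 \<le> sph_dist (X i) (X (i + 1))" by (intro sph_dist_bounds X)
    then have "norm (sph_log (X i) (X (i + 1))) \<le> sph_dist (X i) (X (i + 1))"
      by (simp add: sph_log_def)
    then show ?thesis using d order_trans by blast
  qed
  have "sph_log (X i) (X i) = 0" using X by (simp add: sph_log_def norm_eq_1)
  then have "chart_interpolation k X t = sph_exp (X i) (s *\<^sub>R sph_log (X i) (X (i + 1)))"
    by (simp add: chart_interpolation_def i_def s_def Let_def)
  then have "norm (chart_interpolation k X t - X i) \<le> 2 * norm (s *\<^sub>R sph_log (X i) (X (i + 1)))"
    using norm_sph_exp_diff_le[OF X] by metis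
  also have "\<dots> \<le> 2 * (1 * \<delta>)"
    using s log mult_mono[OF s(2) log] by simp
  finally show ?thesis by (simp add: i_def)
qed

lemma norm_diff_le_sph_dist:
  fixes p q :: "'a::euclidean_space"
  assumes "norm p = 1" "norm q = 1"
  shows "norm (p - q) \<le> sph_dist p q"
proof -
  have "(norm (p - q))\<^sup>2 = 2 - 2 * (p \<bullet> q)"
    using assms by (simp add: power2_norm_eq_inner inner_diff_left inner_diff_right inner_commute norm_eq_1)
  also have "\<dots> \<le> (sph_dist p q)\<^sup>2"
    using inner_ge_one_minus_sq[OF assms order_refl] by simp
  finally show ?thesis using sph_dist_bounds(1)[OF assms] by (rule power2_le_imp_le)
qed

text \<open>The contraction keeps the hypothesis on the distances alive, so the single step can be iterated.
  The defect is quadratic in the distances and therefore decays like \<open>(0.7\<^sup>2)\<^sup>k = 0.49\<^sup>k\<close>.\<close>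

lemma riemannian_four_point_iterates:
  fixes x :: "int \<Rightarrow> 'a::euclidean_space"
  defines "X \<equiv> \<lambda>k. (riemannian_rule (four_point_mask (1 / 16)) ^^ k) x"
  assumes x: "\<And>i. norm (x i) = 1" and d: "\<And>i. sph_dist (x i) (x (i + 1)) \<le> \<delta>" "\<delta> < 31 / 100"
  shows "norm (X k i) = 1" and "sph_dist (X k i) (X k (i + 1)) \<le> \<delta> * (7 / 10) ^ k"
    and "riemannian_rule_defined (four_point_mask (1 / 16)) (X k)"
    and "X (Suc k) (2 * i) = X k i"
    and "norm (X (Suc k) (2 * i + 1) - linear_rule (four_point_mask (1 / 16)) (X k) (2 * i + 1))
       \<le> 6 * \<delta>\<^sup>2 * (49 / 100) ^ k"
proof -
  have Suc: "X (Suc k) = riemannian_rule (four_point_mask (1 / 16)) (X k)" for k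
    by (simp add: X_def)
  have \<delta>0: "0 \<le> \<delta>" using sph_dist_bounds(1)[OF x x, of 0 1] d(1)[of 0] by simp
  have small: "\<delta> * (7 / 10) ^ k < 31 / 100" for k
  proof -
    have "\<delta> * (7 / 10) ^ k \<le> \<delta> * 1" using \<delta>0 by (intro mult_left_mono) (auto simp: power_le_one)
    then show ?thesis using d(2) by simp
  qed
  have inv: "(\<forall>i. norm (X k i) = 1) \<and> (\<forall>i. sph_dist (X k i) (X k (i + 1)) \<le> \<delta> * (7 / 10) ^ k)" for k
  proof (induction k)
    case 0
    then show ?case using x d by (simp add: X_def)
  next
    case (Suc k)
    then have s: "\<And>i. norm (X k i) = 1" "\<And>i. sph_dist (X k i) (X k (i + 1)) \<le> \<delta> * (7 / 10) ^ k"
      by auto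
    show ?case
      using riemannian_four_point_step(3,4)[where x = "X k" and \<delta> = "\<delta> * (7 / 10) ^ k", OF s small]
      by (simp add: \<open>X (Suc k) = _\<close> mult_ac)
  qed
  then have X: "\<And>i. norm (X k i) = 1" "\<And>i. sph_dist (X k i) (X k (i + 1)) \<le> \<delta> * (7 / 10) ^ k"
    for k by auto
  show "norm (X k i) = 1" "sph_dist (X k i) (X k (i + 1)) \<le> \<delta> * (7 / 10) ^ k" by (fact X)+
  note step = riemannian_four_point_step[where x = "X k" and \<delta> = "\<delta> * (7 / 10) ^ k", OF X small]
  show "riemannian_rule_defined (four_point_mask (1 / 16)) (X k)" by (rule step)
  show "X (Suc k) (2 * i) = X k i" unfolding Suc by (rule step)
  have "(\<delta> * (7 / 10) ^ k)\<^sup>2 = \<delta>\<^sup>2 * (49 / 100) ^ k"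
    by (simp add: power_mult_distrib power2_eq_square flip: power_mult_distrib)
  then show "norm (X (Suc k) (2 * i + 1) - linear_rule (four_point_mask (1 / 16)) (X k) (2 * i + 1))
       \<le> 6 * \<delta>\<^sup>2 * (49 / 100) ^ k"
    unfolding Suc using step(5)[of i] by (simp add: mult_ac)
qed

theorem corollary12:
  fixes n :: nat and x :: "int \<Rightarrow> 'a::euclidean_space"
  assumes "n \<ge> 2" and "DIM('a) = n + 1"
    and "\<And>i. x i \<in> sphere 0 1"
    and "(SUP l. sph_dist (x l) (x (l + 1))) < 0.31"
  shows "\<exists>f. riemannian_rule_converges_to (four_point_mask (1 / 16)) x f \<and>
             f C1_differentiable_on UNIV"
proof -
  define \<delta> where "\<delta> = (SUP l. sph_dist (x l) (x (l + 1)))"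
  define X where "X k = (riemannian_rule (four_point_mask (1 / 16)) ^^ k) x" for k
  have x: "norm (x i) = 1" for i using assms(3)[of i] by simp
  have "bdd_above (range (\<lambda>l. sph_dist (x l) (x (l + 1))))"
    by (rule bdd_aboveI2[where M = pi]) (intro sph_dist_bounds x)
  then have d: "sph_dist (x i) (x (i + 1)) \<le> \<delta>" for i
    unfolding \<delta>_def by (rule cSUP_upper[OF UNIV_I])
  have \<delta>: "\<delta> < 31 / 100" using assms(4) by (simp add: \<delta>_def)
  note iter = riemannian_four_point_iterates[where x = x and \<delta> = \<delta>, OF x d \<delta>, folded X_def]
  have \<delta>0: "0 \<le> \<delta>" using sph_dist_bounds(1)[OF x x, of 0 1] d[of 0] by simp
  \<comment> \<open>one constant, \<open>6 * \<delta>\<close>, for both rates\<close>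
  have odd: "norm (X (Suc k) (2 * i + 1) - linear_rule (four_point_mask (1 / 16)) (X k) (2 * i + 1))
      \<le> 6 * \<delta> * (49 / 100) ^ k" for k i
  proof -
    have "\<delta>\<^sup>2 \<le> \<delta>" using \<delta>0 \<delta> by (simp add: power2_eq_square mult_left_le)
    then have "6 * \<delta>\<^sup>2 * (49 / 100) ^ k \<le> 6 * \<delta> * (49 / 100) ^ k" by (intro mult_right_mono) auto
    then show ?thesis using iter(5) order_trans by blast
  qed
  have diff: "norm (X k (i + 1) - X k i) \<le> 6 * \<delta> * (7 / 10) ^ k" for k i
  proof -
    have "norm (X k (i + 1) - X k i) \<le> \<delta> * (7 / 10) ^ k"
      using norm_diff_le_sph_dist[OF iter(1) iter(1)] iter(2) order_trans
      by (metis norm_minus_commute)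
    also have "\<dots> \<le> 6 * \<delta> * (7 / 10) ^ k" using \<delta>0 by (intro mult_right_mono) auto
    finally show ?thesis .
  qed
  obtain f where f: "\<And>k t. norm (X k \<lfloor>t * 2 ^ k :: real\<rfloor> - f t) \<le> 10 / 3 * (6 * \<delta>) * (7 / 10) ^ k"
    and C1: "f C1_differentiable_on UNIV"
    using perturbed_four_point_C1[OF iter(4) odd diff] by blast
  have "norm (f t) = 1" for t
  proof -
    have "(\<lambda>k. X k \<lfloor>t * 2 ^ k\<rfloor>) \<longlonglongrightarrow> f t"
    proof (rule Lim_null_comparison[THEN LIM_zero_cancel])
      show "\<forall>\<^sub>F k in sequentially. norm (X k \<lfloor>t * 2 ^ k\<rfloor> - f t) \<le> 10 / 3 * (6 * \<delta>) * (7 / 10) ^ k"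
        using f by simp
      show "(\<lambda>k. 10 / 3 * (6 * \<delta>) * (7 / 10) ^ k) \<longlonglongrightarrow> 0"
        by (intro tendsto_mult_right_zero LIMSEQ_power_zero) simp
    qed
    then have "(\<lambda>k. norm (X k \<lfloor>t * 2 ^ k\<rfloor>)) \<longlonglongrightarrow> norm (f t)" by (rule tendsto_norm)
    then show ?thesis by (simp add: iter(1) LIMSEQ_const_iff)
  qed
  moreover have "uniform_limit K (\<lambda>k. chart_interpolation k (X k)) f sequentially" for K
  proof (rule uniform_limitI)
    fix e :: real assume "0 < e"
    moreover have "(\<lambda>k. 22 * \<delta> * (7 / 10) ^ k) \<longlonglongrightarrow> 0"
      by (intro tendsto_mult_right_zero LIMSEQ_power_zero) simp
    ultimately have "\<forall>\<^sub>F k in sequentially. 22 * \<delta> * (7 / 10) ^ k < e"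
      by (intro order_tendstoD)
    then show "\<forall>\<^sub>F k in sequentially. \<forall>t\<in>K. dist (chart_interpolation k (X k) t) (f t) < e"
    proof (rule eventually_mono, intro ballI)
      fix k t assume k: "22 * \<delta> * (7 / 10) ^ k < e"
      have "norm (chart_interpolation k (X k) t - X k \<lfloor>t * 2 ^ k\<rfloor>) \<le> 2 * (\<delta> * (7 / 10) ^ k)"
        by (intro chart_interpolation_near iter)
      then have "norm (chart_interpolation k (X k) t - f t) \<le> 22 * \<delta> * (7 / 10) ^ k"
        using norm_diff_triangle_le[OF _ f[of k t]] by fastforce
      then show "dist (chart_interpolation k (X k) t) (f t) < e" using k by (simp add: dist_norm)
    qed
  qed
  moreover have "continuous_on UNIV f"
    using C1 by (rule C1_differentiable_imp_continuous_on)
  ultimately show ?thesis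
    using iter(3) C1 unfolding riemannian_rule_converges_to_def X_def by (intro exI[of _ f]) auto
qed

end
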